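(* Let $h(n,k)$ denote the number of nonisomorphic $k$-element graded posets $P$ of rank $n$ with $\hat0$ and $\hat1$ for which the flag $h$-vector $\beta_P$ is multiplicity-free. Let $$U(x,y)=\sum_{n\ge1}\sum_{k\ge2}h(n,k)x^ny^k.$$ Then $$U(x,y)=\frac{xy^2(1-xy^2)(1-3xy^2)}{1-xy-5xy^2+4x^2y^3+5x^2y^4-3x^3y^5}.$$
   Context: For a finite graded poset $P$ of rank $n$ with $\hat0,\hat1$ and rank function $\rho$, the flag $f$-vector is $\alpha_P(S)=$ number of chains $C$ of $P$ with $\{\rho(t):t\in C\}=S$, for $S\subseteq[n-1]$, and the flag $h$-vector is $\beta_P(S)=\sum_{T\subseteq S}(-1)^{\#(S-T)}\alpha_P(T)$. $\beta_P$ is multiplicity-free if $\beta_P(S)\in\{0,1,-1\}$ for all $S\subseteq[n-1]$. *)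

theory Defs
  imports Complex_Main "HOL-Computational_Algebra.Formal_Power_Series"
begin

text \<open>
  A finite poset is a relation \<open>r\<close> (\<open>(x, y) \<in> r\<close> meaning \<open>x \<le> y\<close>) with \<open>Partial_order r\<close>; its set
  of elements is \<open>Field r\<close>. The library set \<open>Chains r\<close> contains the empty chain, and its members are
  subsets of \<open>Field r\<close>.
\<close>

definition maximal_chain :: "'a rel \<Rightarrow> 'a set \<Rightarrow> bool" where
  "maximal_chain r C \<longleftrightarrow> C \<in> Chains r \<and> (\<forall>D \<in> Chains r. C \<subseteq> D \<longrightarrow> D = C)"

definition graded_poset :: "nat \<Rightarrow> 'a rel \<Rightarrow> bool" where
  "graded_poset n r \<longleftrightarrow>
     finite (Field r) \<and> Partial_order r \<and> (\<forall>C. maximal_chain r C \<longrightarrow> card C = n + 1)"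

definition has_bot :: "'a rel \<Rightarrow> bool" where
  "has_bot r \<longleftrightarrow> (\<exists>z \<in> Field r. \<forall>x \<in> Field r. (z, x) \<in> r)"

definition has_top :: "'a rel \<Rightarrow> bool" where
  "has_top r \<longleftrightarrow> (\<exists>u \<in> Field r. \<forall>x \<in> Field r. (x, u) \<in> r)"

text \<open>
  The rank of \<open>t\<close> is the length (number of elements minus one) of a longest chain of elements
  \<open>\<le> t\<close>. The lemmas \<open>poset_rank_minimal\<close> and \<open>poset_rank_cover\<close> below show that on a graded poset
  this is the usual rank function.
\<close>

definition poset_rank :: "'a rel \<Rightarrow> 'a \<Rightarrow> nat" where
  "poset_rank r t = Max {card C - 1 | C. C \<in> Chains r \<and> C \<subseteq> under r t}"

definition flag_f :: "'a rel \<Rightarrow> nat set \<Rightarrow> nat" where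
  "flag_f r S = card {C \<in> Chains r. poset_rank r ` C = S}"

definition flag_h :: "'a rel \<Rightarrow> nat set \<Rightarrow> int" where
  "flag_h r S = (\<Sum>T \<in> Pow S. (-1) ^ card (S - T) * int (flag_f r T))"

definition flag_h_multiplicity_free :: "nat \<Rightarrow> 'a rel \<Rightarrow> bool" where
  "flag_h_multiplicity_free n r \<longleftrightarrow> (\<forall>S \<subseteq> {1..<n}. flag_h r S \<in> {0, 1, -1})"

definition poset_iso :: "'a rel \<Rightarrow> 'b rel \<Rightarrow> bool" where
  "poset_iso r s \<longleftrightarrow> (\<exists>f. bij_betw f (Field r) (Field s) \<and>
     (\<forall>x \<in> Field r. \<forall>y \<in> Field r. (x, y) \<in> r \<longleftrightarrow> (f x, f y) \<in> s))"

text \<open>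
  Every \<open>k\<close>-element poset is isomorphic to one with set of elements \<open>{..<k}\<close> (lemma
  \<open>poset_iso_standard_carrier\<close>), so isomorphism types are counted on this carrier.
\<close>

definition mf_posets :: "nat \<Rightarrow> nat \<Rightarrow> nat rel set" where
  "mf_posets n k = {r. Field r = {..<k} \<and> graded_poset n r \<and> has_bot r \<and> has_top r \<and>
     flag_h_multiplicity_free n r}"

definition num_mf_posets :: "nat \<Rightarrow> nat \<Rightarrow> nat" where
  "num_mf_posets n k =
     card (mf_posets n k // {(r, s). r \<in> mf_posets n k \<and> s \<in> mf_posets n k \<and> poset_iso r s})"

text \<open>
  Power series in \<open>x\<close> and \<open>y\<close> are power series in \<open>x\<close> whose coefficients are power series in \<open>y\<close>.
\<close>

definition varx :: "rat fps fps" where "varx = fps_X"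

definition vary :: "rat fps fps" where "vary = fps_const fps_X"

definition U_series :: "rat fps fps" where
  "U_series = Abs_fps (\<lambda>n. Abs_fps (\<lambda>k.
     if n \<ge> 1 \<and> k \<ge> 2 then of_nat (num_mf_posets n k) else 0))"


subsection \<open>Adequacy of the definitions\<close>

lemma U_series_nth:
  "fps_nth (fps_nth U_series n) k = (if n \<ge> 1 \<and> k \<ge> 2 then of_nat (num_mf_posets n k) else 0)"
  by (simp add: U_series_def)

lemma vars_monomial_nth:
  "fps_nth (fps_nth (varx ^ i * vary ^ j) n) k = (if n = i \<and> k = j then 1 else 0)"
  by (simp add: varx_def vary_def fps_X_power_mult_nth fps_const_power)

text \<open>
  The coefficient ring \<open>rat fps\<close> is not a field, but division by a series whose constant term with
  respect to \<open>x\<close> is 1 is genuine division.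
\<close>

lemma fps_fps_divide_cancel:
  fixes f g :: "rat fps fps"
  assumes "fps_nth g 0 = 1"
  shows "f / g * g = f"
proof -
  have sd: "subdegree g = 0" using assms by simp
  have "g * inverse g = 1"
    using fps_right_inverse[of g "inverse (fps_nth g 0)"] assms
    by (simp add: fps_inverse_def[of g])
  then have "inverse g * g = 1" by (simp only: mult.commute)
  then show ?thesis
    by (simp add: fps_divide_def sd mult.assoc)
qed

lemma equiv_poset_iso:
  "equiv A {(r :: 'a rel, s). r \<in> A \<and> s \<in> A \<and> poset_iso r s}"
proof (rule equivI)
  show "refl_on A {(r, s). r \<in> A \<and> s \<in> A \<and> poset_iso r s}"
    by (auto simp: refl_on_def poset_iso_def intro!: exI[of _ id])
  show "sym {(r, s). r \<in> A \<and> s \<in> A \<and> poset_iso r s}"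
  proof (rule symI, clarsimp)
    fix r s :: "'a rel" assume "poset_iso r s"
    then obtain f where f: "bij_betw f (Field r) (Field s)"
      "\<forall>x \<in> Field r. \<forall>y \<in> Field r. (x, y) \<in> r \<longleftrightarrow> (f x, f y) \<in> s"
      unfolding poset_iso_def by blast
    let ?g = "inv_into (Field r) f"
    have "bij_betw ?g (Field s) (Field r)" using f(1) by (rule bij_betw_inv_into)
    moreover have "(x, y) \<in> s \<longleftrightarrow> (?g x, ?g y) \<in> r" if "x \<in> Field s" "y \<in> Field s" for x y
    proof -
      have "?g x \<in> Field r" "?g y \<in> Field r" "f (?g x) = x" "f (?g y) = y"
        using that f(1) by (auto simp: bij_betw_def inv_into_into f_inv_into_f)
      then show ?thesis using f(2) by metis
    qed
    ultimately show "poset_iso s r" unfolding poset_iso_def by blast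
  qed
  show "trans {(r, s). r \<in> A \<and> s \<in> A \<and> poset_iso r s}"
  proof (rule transI, clarsimp)
    fix r s t :: "'a rel" assume "poset_iso r s" "poset_iso s t"
    then obtain f g where f: "bij_betw f (Field r) (Field s)"
      "\<forall>x \<in> Field r. \<forall>y \<in> Field r. (x, y) \<in> r \<longleftrightarrow> (f x, f y) \<in> s"
      and g: "bij_betw g (Field s) (Field t)"
      "\<forall>x \<in> Field s. \<forall>y \<in> Field s. (x, y) \<in> s \<longleftrightarrow> (g x, g y) \<in> t"
      unfolding poset_iso_def by blast
    have "bij_betw (g \<circ> f) (Field r) (Field t)" using f(1) g(1) by (rule bij_betw_trans)
    moreover have "\<forall>x \<in> Field r. \<forall>y \<in> Field r. (x, y) \<in> r \<longleftrightarrow> ((g \<circ> f) x, (g \<circ> f) y) \<in> t"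
      using f(2) g(2) bij_betwE[OF f(1)] by simp
    ultimately show "poset_iso r t" unfolding poset_iso_def by blast
  qed
qed auto

lemma poset_iso_standard_carrier:
  fixes r :: "'a rel"
  assumes "finite (Field r)" "Partial_order r" "card (Field r) = k"
  obtains s :: "nat rel" where "Field s = {..<k}" "Partial_order s" "poset_iso r s"
proof -
  obtain f where f: "bij_betw f (Field r) {..<k}"
    using assms(1,3) by (metis bij_betw_iff_card card_lessThan finite_lessThan)
  define s where "s = (\<lambda>(x, y). (f x, f y)) ` r"
  have refl: "(x, x) \<in> r" if "x \<in> Field r" for x
    using assms(2) that by (auto simp: partial_order_on_def preorder_on_def refl_on_def)
  have inj: "inj_on f (Field r)" and im: "f ` Field r = {..<k}" using f by (auto simp: bij_betw_def)
  have mem: "(x, y) \<in> r \<longleftrightarrow> (f x, f y) \<in> s" if "x \<in> Field r" "y \<in> Field r" for x y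
  proof
    assume "(f x, f y) \<in> s"
    then obtain a b where ab: "(a, b) \<in> r" "f a = f x" "f b = f y" by (auto simp: s_def)
    then have "a = x" "b = y" using inj that by (auto simp: inj_on_def dest: FieldI1 FieldI2)
    with ab show "(x, y) \<in> r" by simp
  qed (force simp: s_def)
  have fld: "Field s = {..<k}"
  proof -
    have "Field s = f ` Field r" by (force simp: s_def Field_def)
    then show ?thesis using im by simp
  qed
  have tr: "trans r" and an: "antisym r"
    using assms(2) by (auto simp: partial_order_on_def preorder_on_def)
  have pre: "\<exists>x\<in>Field r. u = f x" if "u \<in> Field s" for u using that fld im by auto
  have "refl_on (Field s) s"
    using pre mem refl by (metis refl_onI)
  moreover have "trans s"
  proof (rule transI)
    fix u v w assume uv: "(u, v) \<in> s" and vw: "(v, w) \<in> s"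
    then obtain x y z where "x \<in> Field r" "y \<in> Field r" "z \<in> Field r" "u = f x" "v = f y" "w = f z"
      using pre by (meson FieldI1 FieldI2)
    then show "(u, w) \<in> s" using uv vw mem tr by (meson transD)
  qed
  moreover have "antisym s"
  proof (rule antisymI)
    fix u v assume uv: "(u, v) \<in> s" and vu: "(v, u) \<in> s"
    then obtain x y where "x \<in> Field r" "y \<in> Field r" "u = f x" "v = f y"
      using pre by (meson FieldI1 FieldI2)
    then show "u = v" using uv vu mem an by (metis antisymD)
  qed
  moreover have "s \<subseteq> Field s \<times> Field s" by (auto intro: FieldI1 FieldI2)
  ultimately have "Partial_order s" by (simp add: partial_order_on_def preorder_on_def)
  moreover have "poset_iso r s"
    unfolding poset_iso_def using f fld mem by auto
  ultimately show ?thesis using that fld by blast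
qed

lemma Chains_subset_Field: "C \<in> Chains r \<Longrightarrow> C \<subseteq> Field r"
  by (auto simp: Chains_def intro: FieldI1)

lemma finite_Chains: "finite (Field r) \<Longrightarrow> finite (Chains r)"
  by (rule finite_subset[of _ "Pow (Field r)"]) (auto dest: Chains_subset_Field)

text \<open>A longest chain below \<open>t\<close> is a maximal chain of the principal order ideal of \<open>t\<close>.\<close>

lemma longest_chain_below:
  assumes fin: "finite (Field r)" and po: "Partial_order r" and t: "t \<in> Field r"
  obtains C where "C \<in> Chains r" "C \<subseteq> under r t" "t \<in> C" "card C = poset_rank r t + 1"
    "\<And>x. (x, t) \<in> r \<Longrightarrow> \<forall>y\<in>C. (x, y) \<in> r \<or> (y, x) \<in> r \<Longrightarrow> x \<in> C"
proof -
  let ?K = "{C. C \<in> Chains r \<and> C \<subseteq> under r t}"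
  let ?N = "{card C - 1 | C. C \<in> Chains r \<and> C \<subseteq> under r t}"
  have refl: "(x, x) \<in> r" if "x \<in> Field r" for x
    using po that by (auto simp: partial_order_on_def preorder_on_def refl_on_def)
  have finK: "finite ?K" using finite_Chains[OF fin] by simp
  have N: "?N = (\<lambda>C. card C - 1) ` ?K" by auto
  have tK: "{t} \<in> ?K" using refl[OF t] by (auto simp: Chains_def under_def)
  have Max: "poset_rank r t \<in> ?N" unfolding poset_rank_def
    by (rule Max_in) (use finK tK N in auto)
  have ub: "card C - 1 \<le> poset_rank r t" if "C \<in> ?K" for C
    unfolding poset_rank_def by (rule Max_ge) (use finK N that in auto)
  have ext: "insert x C \<in> ?K"
    if "C \<in> ?K" "(x, t) \<in> r" "\<forall>y\<in>C. (x, y) \<in> r \<or> (y, x) \<in> r" for x C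
    using that refl[of x] by (auto simp: Chains_def under_def intro: FieldI1)
  have extt: "insert t C \<in> ?K" if "C \<in> ?K" for C
    using that by (intro ext) (auto simp: under_def refl[OF t])
  have finC: "finite C" if "C \<in> ?K" for C
    using that Chains_subset_Field[of C r] finite_subset[OF _ fin] by auto
  obtain C0 where C0: "C0 \<in> ?K" "card C0 - 1 = poset_rank r t" using Max by auto
  define C where "C = insert t C0"
  have C: "C \<in> ?K" "t \<in> C" using extt[OF C0(1)] by (auto simp: C_def)
  have pos: "card C > 0" using C finC[OF C(1)] by (auto simp: card_gt_0_iff)
  have "card C0 \<le> card C" unfolding C_def by (rule card_insert_le)
  then have cC: "card C = poset_rank r t + 1" using C0(2) ub[OF C(1)] pos by linarith
  have mx: "x \<in> C" if x: "(x, t) \<in> r" "\<forall>y\<in>C. (x, y) \<in> r \<or> (y, x) \<in> r" for x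
  proof (rule ccontr)
    assume "x \<notin> C"
    then have "card (insert x C) = poset_rank r t + 2" using cC finC[OF C(1)] by simp
    then show False using ub[OF ext[OF C(1) x]] by simp
  qed
  show ?thesis using that[of C] C cC mx by blast
qed

lemma longest_chain_above:
  assumes fin: "finite (Field r)" and po: "Partial_order r" and t: "t \<in> Field r"
  obtains C where "C \<in> Chains r" "\<And>y. y \<in> C \<Longrightarrow> (t, y) \<in> r" "t \<in> C"
    "\<And>x. (t, x) \<in> r \<Longrightarrow> \<forall>y\<in>C. (x, y) \<in> r \<or> (y, x) \<in> r \<Longrightarrow> x \<in> C"
proof -
  have "finite (Field (r\<inverse>))" "Partial_order (r\<inverse>)" "t \<in> Field (r\<inverse>)" using assms by auto
  from longest_chain_below[OF this] obtain C where C: "C \<in> Chains (r\<inverse>)" "C \<subseteq> under (r\<inverse>) t" "t \<in> C"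
    "\<And>x. (x, t) \<in> r\<inverse> \<Longrightarrow> \<forall>y\<in>C. (x, y) \<in> r\<inverse> \<or> (y, x) \<in> r\<inverse> \<Longrightarrow> x \<in> C" by metis
  show ?thesis
  proof (rule that[of C])
    show "C \<in> Chains r" using C(1) by (auto simp: Chains_def)
    show "(t, y) \<in> r" if "y \<in> C" for y using C(2) that by (auto simp: under_def)
    show "t \<in> C" by fact
    show "x \<in> C" if "(t, x) \<in> r" "\<forall>y\<in>C. (x, y) \<in> r \<or> (y, x) \<in> r" for x
      using C(4)[of x] that by auto
  qed
qed

lemma poset_rank_minimal:
  assumes "finite (Field r)" "Partial_order r" "t \<in> Field r" "\<And>x. (x, t) \<in> r \<Longrightarrow> x = t"
  shows "poset_rank r t = 0"
proof -
  obtain C where C: "C \<subseteq> under r t" "t \<in> C" "card C = poset_rank r t + 1"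
    using longest_chain_below[OF assms(1-3)] by metis
  then have "C = {t}" using assms(4) by (auto simp: under_def)
  then show ?thesis using C(3) by simp
qed

lemma poset_rank_cover:
  assumes gr: "graded_poset n r" and st: "(s, t) \<in> r" "s \<noteq> t"
    and cover: "\<And>x. (s, x) \<in> r \<Longrightarrow> (x, t) \<in> r \<Longrightarrow> x = s \<or> x = t"
  shows "poset_rank r t = poset_rank r s + 1"
proof -
  have fin: "finite (Field r)" and po: "Partial_order r"
    and len: "\<And>C. maximal_chain r C \<Longrightarrow> card C = n + 1"
    using gr by (auto simp: graded_poset_def)
  have tr: "trans r" and an: "antisym r"
    using po by (auto simp: partial_order_on_def preorder_on_def)
  have s: "s \<in> Field r" and t: "t \<in> Field r" using st by (auto intro: FieldI1 FieldI2)
  obtain C where C: "C \<in> Chains r" "C \<subseteq> under r s" "s \<in> C" "card C = poset_rank r s + 1"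
    "\<And>x. (x, s) \<in> r \<Longrightarrow> \<forall>y\<in>C. (x, y) \<in> r \<or> (y, x) \<in> r \<Longrightarrow> x \<in> C"
    using longest_chain_below[OF fin po s] by metis
  obtain D where D: "D \<in> Chains r" "D \<subseteq> under r t" "t \<in> D" "card D = poset_rank r t + 1"
    "\<And>x. (x, t) \<in> r \<Longrightarrow> \<forall>y\<in>D. (x, y) \<in> r \<or> (y, x) \<in> r \<Longrightarrow> x \<in> D"
    using longest_chain_below[OF fin po t] by metis
  obtain E where E: "E \<in> Chains r" "\<And>y. y \<in> E \<Longrightarrow> (t, y) \<in> r" "t \<in> E"
    "\<And>x. (t, x) \<in> r \<Longrightarrow> \<forall>y\<in>E. (x, y) \<in> r \<or> (y, x) \<in> r \<Longrightarrow> x \<in> E"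
    using longest_chain_above[OF fin po t] by metis
  have Cs: "\<And>y. y \<in> C \<Longrightarrow> (y, s) \<in> r" and Dt: "\<And>y. y \<in> D \<Longrightarrow> (y, t) \<in> r"
    using C(2) D(2) by (auto simp: under_def)
  have ce: "(y, z) \<in> r" if "y \<in> C" "z \<in> E" for y z
    using transD[OF tr Cs[OF that(1)] transD[OF tr st(1) E(2)[OF that(2)]]] .
  have de: "(y, z) \<in> r" if "y \<in> D" "z \<in> E" for y z
    using transD[OF tr Dt[OF that(1)] E(2)[OF that(2)]] .
  have "maximal_chain r (C \<union> E)" unfolding maximal_chain_def
  proof (intro conjI ballI impI)
    show "C \<union> E \<in> Chains r" using C(1) E(1) ce by (auto simp: Chains_def)
    fix F assume F: "F \<in> Chains r" "C \<union> E \<subseteq> F"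
    have "x \<in> C \<union> E" if x: "x \<in> F" for x
    proof -
      have cmp: "(x, y) \<in> r \<or> (y, x) \<in> r" if "y \<in> C \<union> E" for y
        using F x that unfolding Chains_def by blast
      have "(x, s) \<in> r \<or> (s, x) \<in> r" "(x, t) \<in> r \<or> (t, x) \<in> r" using cmp C(3) E(3) by auto
      then consider "(x, s) \<in> r" | "(t, x) \<in> r" | "(s, x) \<in> r" "(x, t) \<in> r" by blast
      then show ?thesis
      proof cases
        case 1 then show ?thesis using C(5)[of x] cmp by blast
      next
        case 2 then show ?thesis using E(4)[of x] cmp by blast
      next
        case 3 then show ?thesis using cover C(3) E(3) by blast
      qed
    qed
    then show "F = C \<union> E" using F(2) by blast
  qed
  then have 1: "card (C \<union> E) = n + 1" by (rule len)
  have "maximal_chain r (D \<union> E)" unfolding maximal_chain_def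
  proof (intro conjI ballI impI)
    show "D \<union> E \<in> Chains r" using D(1) E(1) de by (auto simp: Chains_def)
    fix F assume F: "F \<in> Chains r" "D \<union> E \<subseteq> F"
    have "x \<in> D \<union> E" if x: "x \<in> F" for x
    proof -
      have cmp: "(x, y) \<in> r \<or> (y, x) \<in> r" if "y \<in> D \<union> E" for y
        using F x that unfolding Chains_def by blast
      then have "(x, t) \<in> r \<or> (t, x) \<in> r" using E(3) by auto
      then show ?thesis using D(5)[of x] E(4)[of x] cmp by blast
    qed
    then show "F = D \<union> E" using F(2) by blast
  qed
  then have 2: "card (D \<union> E) = n + 1" by (rule len)
  have finCDE: "finite C" "finite D" "finite E"
    using C(1) D(1) E(1) Chains_subset_Field finite_subset[OF _ fin] by blast+
  have "C \<inter> E = {}"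
  proof (rule ccontr)
    assume "C \<inter> E \<noteq> {}"
    then obtain x where "(x, s) \<in> r" "(t, x) \<in> r" using Cs E(2) by blast
    then have "(t, s) \<in> r" using tr by (meson transD)
    then show False using st an by (meson antisymD)
  qed
  then have 3: "card (C \<union> E) = card C + card E" using finCDE by (simp add: card_Un_disjoint)
  have "D \<inter> E = {t}" using D(3) E(2,3) Dt an by (auto dest: antisymD)
  then have 4: "card (D \<union> E) + 1 = card D + card E"
    using card_Un_Int[of D E] finCDE by simp
  show ?thesis using 1 2 3 4 C(4) D(4) by linarith
qed

end

theory Submission
  imports Defs
begin

text \<open>
  Since \<open>\<beta>({i})\<close> is the size of level \<open>i\<close> minus 1, all levels of a multiplicity-free poset have at
  most two elements. This is also sufficient: up to sign, \<open>\<beta>(S)\<close> is a reduced Euler characteristic,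
  and removing the lowest level in \<open>S\<close> multiplies it by \<open>1 - c\<close>, where \<open>c \<le> 2\<close> is the number of its
  elements that lie below the whole next level in \<open>S\<close>.
  The isomorphism types of such posets are the words accepted by a finite automaton which reads the
  levels from bottom to top. It remembers whether the current level has one element, two elements
  that an automorphism of the part read so far can swap, or two elements that are distinguishable.
  With \<open>A\<close>, \<open>S\<close>, \<open>R\<close> the generating functions of these three states,
  \<open>A = y + x y (A + S + R)\<close>, \<open>S = x y\<^sup>2 (A + 2 S + R)\<close>, \<open>R = x y\<^sup>2 (S + 3 R)\<close> and \<open>U = A - y\<close>.
\<close>

section \<open>Finite posets\<close>

lemma Chains_comparable: "C \<in> Chains r \<Longrightarrow> x \<in> C \<Longrightarrow> y \<in> C \<Longrightarrow> (x, y) \<in> r \<or> (y, x) \<in> r"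
  unfolding Chains_def by blast

locale finite_poset =
  fixes r :: "'a rel"
  assumes finite_Field: "finite (Field r)"
    and partial_order: "Partial_order r"
begin

abbreviation comparable :: "'a \<Rightarrow> 'a \<Rightarrow> bool" where
  "comparable x y \<equiv> (x, y) \<in> r \<or> (y, x) \<in> r"

lemma refl: "x \<in> Field r \<Longrightarrow> (x, x) \<in> r"
  using partial_order by (auto simp: partial_order_on_def preorder_on_def refl_on_def)

lemma trans: "(x, y) \<in> r \<Longrightarrow> (y, z) \<in> r \<Longrightarrow> (x, z) \<in> r"
  using partial_order by (auto simp: partial_order_on_def preorder_on_def dest: transD)

lemma antisym: "(x, y) \<in> r \<Longrightarrow> (y, x) \<in> r \<Longrightarrow> x = y"
  using partial_order by (auto simp: partial_order_on_def dest: antisymD)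

lemma finite_chain: "C \<in> Chains r \<Longrightarrow> finite C"
  using Chains_subset_Field finite_Field finite_subset by blast

lemma insert_in_Chains:
  assumes "C \<in> Chains r" "x \<in> Field r" "\<forall>y\<in>C. comparable x y"
  shows "insert x C \<in> Chains r"
  using assms refl[of x] by (auto simp: Chains_def)

lemma maximal_chain_saturated:
  assumes "maximal_chain r C" "x \<in> Field r" "\<forall>y\<in>C. comparable x y"
  shows "x \<in> C"
  using assms insert_in_Chains[of C x] by (auto simp: maximal_chain_def)

lemma saturated_chain_maximal:
  assumes "C \<in> Chains r" "\<And>x. x \<in> Field r \<Longrightarrow> \<forall>y\<in>C. comparable x y \<Longrightarrow> x \<in> C"
  shows "maximal_chain r C"
  unfolding maximal_chain_def
proof (intro conjI ballI impI equalityI subsetI)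
  fix D x assume D: "D \<in> Chains r" "C \<subseteq> D" "x \<in> D"
  then have "\<forall>y\<in>C. comparable x y" using Chains_comparable[OF D(1,3)] by blast
  then show "x \<in> C" using assms(2) D(1,3) Chains_subset_Field by blast
qed (use assms(1) in auto)

lemma card_chain_le_poset_rank:
  assumes "C \<in> Chains r" "C \<subseteq> under r t"
  shows "card C \<le> Suc (poset_rank r t)"
proof -
  have "{card C - 1 | C. C \<in> Chains r \<and> C \<subseteq> under r t} \<subseteq> (\<lambda>C. card C - 1) ` Chains r" by blast
  then have "finite {card C - 1 | C. C \<in> Chains r \<and> C \<subseteq> under r t}"
    using finite_Chains[OF finite_Field] finite_surj by blast
  then have "card C - 1 \<le> poset_rank r t"
    unfolding poset_rank_def by (rule Max_ge) (use assms in blast)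
  then show ?thesis by simp
qed

lemma poset_rank_less:
  assumes "(x, y) \<in> r" "x \<noteq> y"
  shows "poset_rank r x < poset_rank r y"
proof -
  have xy: "x \<in> Field r" "y \<in> Field r" using assms by (auto intro: FieldI1 FieldI2)
  obtain C where C: "C \<in> Chains r" "C \<subseteq> under r x" "card C = Suc (poset_rank r x)"
    using longest_chain_below[OF finite_Field partial_order xy(1)] by (metis Suc_eq_plus1)
  have below: "(c, y) \<in> r" "c \<noteq> y" if "c \<in> C" for c
    using that C(2) assms trans antisym by (auto simp: under_def)
  have "insert y C \<in> Chains r" "insert y C \<subseteq> under r y"
    using insert_in_Chains[OF C(1) xy(2)] below refl[OF xy(2)] by (auto simp: under_def)
  then have "card (insert y C) \<le> Suc (poset_rank r y)" by (rule card_chain_le_poset_rank)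
  moreover have "y \<notin> C" using below(2) by blast
  ultimately show ?thesis using finite_chain[OF C(1)] C(3) by simp
qed

text \<open>The negative of the reduced Euler characteristic of the order complex of \<open>A\<close>.\<close>

definition signed_chain_count :: "'a set \<Rightarrow> int" where
  "signed_chain_count A = (\<Sum>C\<in>{C \<in> Chains r. C \<subseteq> A}. (-1) ^ card C)"

lemma signed_chain_count_empty: "signed_chain_count {} = 1"
proof -
  have "{C \<in> Chains r. C \<subseteq> {}} = {{}}" by (auto simp: Chains_def)
  then show ?thesis by (simp add: signed_chain_count_def)
qed

lemma chains_insert:
  assumes "v \<in> Field r"
  shows "{C \<in> Chains r. C \<subseteq> insert v A} =
    {C \<in> Chains r. C \<subseteq> A} \<union> insert v ` {C \<in> Chains r. C \<subseteq> {x \<in> A. comparable x v}}"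
proof (intro equalityI subsetI)
  fix C assume C: "C \<in> {C \<in> Chains r. C \<subseteq> insert v A}"
  show "C \<in> {C \<in> Chains r. C \<subseteq> A} \<union> insert v ` {C \<in> Chains r. C \<subseteq> {x \<in> A. comparable x v}}"
  proof (cases "v \<in> C")
    case True
    then have "C - {v} \<in> {C \<in> Chains r. C \<subseteq> {x \<in> A. comparable x v}}"
      using C Chains_comparable[of C r v] by (auto simp: Chains_def)
    moreover have "C = insert v (C - {v})" using True by blast
    ultimately show ?thesis by blast
  qed (use C in auto)
next
  fix C assume "C \<in> {C \<in> Chains r. C \<subseteq> A} \<union>
    insert v ` {C \<in> Chains r. C \<subseteq> {x \<in> A. comparable x v}}"
  then show "C \<in> {C \<in> Chains r. C \<subseteq> insert v A}"
    using insert_in_Chains[OF _ assms] by blast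
qed

lemma signed_chain_count_insert:
  assumes "v \<in> Field r" "v \<notin> A"
  shows "signed_chain_count (insert v A) =
    signed_chain_count A - signed_chain_count {x \<in> A. comparable x v}"
proof -
  let ?chains = "\<lambda>A. {C \<in> Chains r. C \<subseteq> A}"
  let ?link = "{x \<in> A. comparable x v}"
  have "signed_chain_count (insert v A) =
      signed_chain_count A + (\<Sum>C\<in>insert v ` ?chains ?link. (-1) ^ card C)"
    unfolding signed_chain_count_def chains_insert[OF assms(1)]
    by (rule sum.union_disjoint) (use finite_Chains[OF finite_Field] assms(2) in auto)
  also have "(\<Sum>C\<in>insert v ` ?chains ?link. (-1 :: int) ^ card C) =
      (\<Sum>C\<in>?chains ?link. (-1) ^ card (insert v C))"
    by (rule sum.reindex_cong[of "insert v"]) (use assms(2) in \<open>auto simp: inj_on_def\<close>)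
  also have "\<dots> = (\<Sum>C\<in>?chains ?link. - ((-1) ^ card C))"
  proof (intro sum.cong HOL.refl)
    fix C assume "C \<in> ?chains ?link"
    then have "finite C" "v \<notin> C" using finite_chain assms(2) by auto
    then show "(-1) ^ card (insert v C) = - ((-1) ^ card C :: int)" by simp
  qed
  also have "\<dots> = - signed_chain_count ?link" by (simp add: signed_chain_count_def sum_negf)
  finally show ?thesis by simp
qed

lemma signed_chain_count_cone:
  assumes "v \<in> A" "v \<in> Field r" "\<And>x. x \<in> A \<Longrightarrow> comparable x v"
  shows "signed_chain_count A = 0"
proof -
  have "{x \<in> A - {v}. comparable x v} = A - {v}" using assms(3) by auto
  then show ?thesis
    using signed_chain_count_insert[of v "A - {v}"] assms(1,2) by (simp add: insert_absorb)
qed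

lemma signed_chain_count_minimal_antichain:
  assumes "finite M" "M \<subseteq> Field r" "M \<inter> A = {}"
    and antichain: "\<And>v w. v \<in> M \<Longrightarrow> w \<in> M \<Longrightarrow> (v, w) \<in> r \<Longrightarrow> v = w"
    and minimal: "\<And>v x. v \<in> M \<Longrightarrow> x \<in> A \<Longrightarrow> (x, v) \<notin> r"
  shows "signed_chain_count (M \<union> A) =
    signed_chain_count A - (\<Sum>v\<in>M. signed_chain_count {x \<in> A. (v, x) \<in> r})"
  using assms
proof (induction M rule: finite_induct)
  case (insert v M)
  have "{x \<in> M \<union> A. comparable x v} = {x \<in> A. (v, x) \<in> r}"
    using insert.hyps(2) insert.prems(3,4) by blast
  then have "signed_chain_count (insert v M \<union> A) =
      signed_chain_count (M \<union> A) - signed_chain_count {x \<in> A. (v, x) \<in> r}"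
    using signed_chain_count_insert[of v "M \<union> A"] insert.hyps(2) insert.prems(1,2) by simp
  moreover have "signed_chain_count (M \<union> A) =
      signed_chain_count A - (\<Sum>v\<in>M. signed_chain_count {x \<in> A. (v, x) \<in> r})"
    using insert.prems by (intro insert.IH) auto
  ultimately show ?case using insert.hyps by simp
qed simp

end

section \<open>Ranked posets\<close>

locale ranked_poset = finite_poset r for r :: "'a rel" +
  fixes n :: nat and rk :: "'a \<Rightarrow> nat"
  assumes bot: "\<exists>z\<in>Field r. rk z = 0 \<and> (\<forall>x\<in>Field r. (z, x) \<in> r)"
    and top: "\<exists>u\<in>Field r. rk u = n \<and> (\<forall>x\<in>Field r. (x, u) \<in> r)"
    and rk_less: "(x, y) \<in> r \<Longrightarrow> x \<noteq> y \<Longrightarrow> rk x < rk y"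
    and ex_cover: "(x, y) \<in> r \<Longrightarrow> x \<noteq> y \<Longrightarrow> \<exists>z. (x, z) \<in> r \<and> (z, y) \<in> r \<and> rk z = Suc (rk x)"
begin

definition level :: "nat \<Rightarrow> 'a set" where
  "level i = {x \<in> Field r. rk x = i}"

lemma rk_mono: "(x, y) \<in> r \<Longrightarrow> rk x \<le> rk y"
  using rk_less by (cases "x = y") (auto simp: less_imp_le)

lemma rk_le_n: "x \<in> Field r \<Longrightarrow> rk x \<le> n"
  using top rk_mono by blast

lemma interpolate:
  assumes "(x, y) \<in> r" "rk x \<le> i" "i \<le> rk y"
  shows "\<exists>z\<in>level i. (x, z) \<in> r \<and> (z, y) \<in> r"
  using assms(2,1,3)
proof (induction i rule: dec_induct)
  case base
  then show ?case using refl[of x] by (auto simp: level_def intro: FieldI1)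
next
  case (step i)
  then obtain z where z: "z \<in> level i" "(x, z) \<in> r" "(z, y) \<in> r" by auto
  then have "rk z = i" "z \<noteq> y" using step.prems(2) by (auto simp: level_def)
  then obtain z' where z': "(z, z') \<in> r" "(z', y) \<in> r" "rk z' = Suc i"
    using ex_cover[OF z(3)] by blast
  then have "z' \<in> level (Suc i)" by (auto simp: level_def intro: FieldI2)
  then show ?case using z(2) z'(1,2) trans by blast
qed

lemma ex_below:
  assumes "x \<in> Field r" "i \<le> rk x"
  shows "\<exists>z\<in>level i. (z, x) \<in> r"
proof -
  obtain b where "rk b = 0" "(b, x) \<in> r" using bot assms(1) by blast
  then show ?thesis using interpolate[of b x i] assms(2) by auto
qed

lemma ex_above:
  assumes "x \<in> Field r" "rk x \<le> i" "i \<le> n"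
  shows "\<exists>z\<in>level i. (x, z) \<in> r"
proof -
  obtain u where "rk u = n" "(x, u) \<in> r" using top assms(1) by blast
  then show ?thesis using interpolate[of x u i] assms(2,3) by auto
qed

lemma finite_level: "finite (level i)"
  using finite_Field by (simp add: level_def)

lemma level_antichain: "x \<in> level i \<Longrightarrow> y \<in> level i \<Longrightarrow> (x, y) \<in> r \<Longrightarrow> x = y"
  using rk_less[of x y] by (auto simp: level_def)

lemma level_eq_empty_iff: "level i = {} \<longleftrightarrow> n < i"
proof
  obtain z where "z \<in> Field r" "rk z = 0" using bot by blast
  then show "n < i" if "level i = {}" using that ex_above[of z i] by (cases "i \<le> n") auto
qed (use rk_le_n in \<open>force simp: level_def\<close>)

lemma level_0: "\<exists>z. level 0 = {z}"
proof -
  obtain z where z: "z \<in> level 0" "\<forall>x\<in>level 0. (z, x) \<in> r" using bot unfolding level_def by blast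
  then have "level 0 = {z}" using level_antichain[OF z(1)] by blast
  then show ?thesis ..
qed

lemma level_n: "\<exists>z. level n = {z}"
proof -
  obtain z where z: "z \<in> level n" "\<forall>x\<in>level n. (x, z) \<in> r" using top unfolding level_def by blast
  then have "level n = {z}" using level_antichain[OF _ z(1)] by blast
  then show ?thesis ..
qed

lemma Chains_rk_le:
  assumes "C \<in> Chains r" "x \<in> C" "y \<in> C" "rk x \<le> rk y"
  shows "(x, y) \<in> r"
  using Chains_comparable[OF assms(1-3)] rk_less[of y x] assms(4) by fastforce

lemma inj_on_rk_Chains: "C \<in> Chains r \<Longrightarrow> inj_on rk C"
  by (rule inj_onI) (metis Chains_rk_le antisym order.refl)

lemma saturated_chain_Suc:
  assumes C: "C \<in> Chains r" "C \<subseteq> under r t" "t \<in> C"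
    and saturated: "\<And>x. (x, t) \<in> r \<Longrightarrow> \<forall>y\<in>C. comparable x y \<Longrightarrow> x \<in> C"
    and x: "x \<in> C" "rk x < rk t"
  shows "Suc (rk x) \<in> rk ` C"
proof -
  obtain y where y: "y \<in> C" "rk x < rk y" "\<And>c. c \<in> C \<Longrightarrow> rk x < rk c \<Longrightarrow> rk y \<le> rk c"
    using ex_has_least_nat[of "\<lambda>c. c \<in> C \<and> rk x < rk c" t rk] C(3) x(2) by blast
  then have "(x, y) \<in> r" using Chains_rk_le[OF C(1) x(1)] by simp
  then obtain z where z: "(x, z) \<in> r" "(z, y) \<in> r" "rk z = Suc (rk x)" using ex_cover y(2) by blast
  have "comparable z c" if c: "c \<in> C" for c
  proof (cases "rk c \<le> rk x")
    case True
    then show ?thesis using Chains_rk_le[OF C(1) c x(1)] z(1) trans by blast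
  next
    case False
    then have "(y, c) \<in> r" using Chains_rk_le[OF C(1) y(1) c] y(3)[OF c] by simp
    then show ?thesis using z(2) trans by blast
  qed
  moreover have "(y, t) \<in> r" using y(1) C(2) by (auto simp: under_def)
  then have "(z, t) \<in> r" using z(2) trans by blast
  ultimately show ?thesis using saturated z(3) by (metis imageI)
qed

lemma card_saturated_chain:
  assumes C: "C \<in> Chains r" "C \<subseteq> under r t" "t \<in> C"
    and saturated: "\<And>x. (x, t) \<in> r \<Longrightarrow> \<forall>y\<in>C. comparable x y \<Longrightarrow> x \<in> C"
  shows "card C = Suc (rk t)"
proof -
  have "i \<in> rk ` C" if "i \<le> rk t" for i
    using that
  proof (induction i)
    case 0
    obtain b where b: "b \<in> Field r" "rk b = 0" "\<forall>x\<in>Field r. (b, x) \<in> r" using bot by blast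
    then have "b \<in> C" using saturated C(1,3) Chains_subset_Field by blast
    then show ?case using b(2) by (metis imageI)
  next
    case (Suc i)
    then obtain x where "x \<in> C" "rk x = i" by auto
    then show ?case using saturated_chain_Suc[OF assms] Suc.prems by auto
  qed
  moreover have "rk c \<le> rk t" if "c \<in> C" for c using that C(2) rk_mono by (auto simp: under_def)
  ultimately have "rk ` C = {..rk t}" by auto
  then show ?thesis using card_image[OF inj_on_rk_Chains[OF C(1)]] by simp
qed

lemma graded: "graded_poset n r"
  unfolding graded_poset_def
proof (intro conjI allI impI)
  fix C assume C: "maximal_chain r C"
  then have chain: "C \<in> Chains r" by (simp add: maximal_chain_def)
  obtain u where u: "u \<in> Field r" "rk u = n" "\<forall>x\<in>Field r. (x, u) \<in> r" using top by blast
  have "C \<subseteq> Field r" using chain by (rule Chains_subset_Field)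
  then have "C \<subseteq> under r u" "u \<in> C"
    using maximal_chain_saturated[OF C u(1)] u(3) by (auto simp: under_def)
  then have "card C = Suc (rk u)"
    using maximal_chain_saturated[OF C]
    by (intro card_saturated_chain[OF chain]) (auto intro: FieldI1)
  then show "card C = n + 1" using u(2) by simp
qed (fact finite_Field partial_order)+

lemma poset_rank_eq: "t \<in> Field r \<Longrightarrow> poset_rank r t = rk t"
  using longest_chain_below[OF finite_Field partial_order, of t] card_saturated_chain[of _ t]
  by (metis Suc_eq_plus1 Suc_inject)

lemma has_bot: "has_bot r" using bot by (auto simp: has_bot_def)

lemma has_top: "has_top r" using top by (auto simp: has_top_def)

end

lemma poset_rank_top:
  assumes gr: "graded_poset n r" and u: "u \<in> Field r" "\<forall>x\<in>Field r. (x, u) \<in> r"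
  shows "poset_rank r u = n"
proof -
  interpret finite_poset r using gr by unfold_locales (simp_all add: graded_poset_def)
  obtain C where C: "C \<in> Chains r" "card C = poset_rank r u + 1"
    "\<And>x. (x, u) \<in> r \<Longrightarrow> \<forall>y\<in>C. comparable x y \<Longrightarrow> x \<in> C"
    using longest_chain_below[OF finite_Field partial_order u(1)] by metis
  then have "maximal_chain r C" using u(2) by (intro saturated_chain_maximal) auto
  then show ?thesis using gr C(2) by (auto simp: graded_poset_def)
qed

lemma graded_poset_ex_cover:
  assumes gr: "graded_poset n r" and xy: "(x, y) \<in> r" "x \<noteq> y"
  shows "\<exists>z. (x, z) \<in> r \<and> (z, y) \<in> r \<and> poset_rank r z = Suc (poset_rank r x)"
proof -
  interpret finite_poset r using gr by unfold_locales (simp_all add: graded_poset_def)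
  let ?above = "\<lambda>z. (x, z) \<in> r \<and> (z, y) \<in> r \<and> x \<noteq> z"
  have "?above y" using xy refl FieldI2 by fast
  then obtain z where z: "?above z" "\<And>c. ?above c \<Longrightarrow> poset_rank r z \<le> poset_rank r c"
    using ex_has_least_nat[of ?above y "poset_rank r"] by blast
  have "c = x \<or> c = z" if "(x, c) \<in> r" "(c, z) \<in> r" for c
    using that z(1) z(2)[of c] poset_rank_less[OF that(2)] trans[OF that(2)] leD by blast
  then have "poset_rank r z = poset_rank r x + 1" using z(1) by (intro poset_rank_cover[OF gr]) auto
  then show ?thesis using z(1) by auto
qed

lemma graded_poset_imp_ranked_poset:
  assumes gr: "graded_poset n r" and "has_bot r" "has_top r"
  shows "ranked_poset r n (poset_rank r)"
proof -
  interpret finite_poset r using gr by unfold_locales (simp_all add: graded_poset_def)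
  obtain b where b: "b \<in> Field r" "\<forall>x\<in>Field r. (b, x) \<in> r"
    using assms(2) by (auto simp: has_bot_def)
  obtain u where u: "u \<in> Field r" "\<forall>x\<in>Field r. (x, u) \<in> r"
    using assms(3) by (auto simp: has_top_def)
  have "x = b" if "(x, b) \<in> r" for x using antisym[OF that] b(2) FieldI1[OF that] by blast
  then have "poset_rank r b = 0" by (rule poset_rank_minimal[OF finite_Field partial_order b(1)])
  moreover have "poset_rank r u = n" using gr u by (rule poset_rank_top)
  ultimately show ?thesis
  proof unfold_locales
    show "\<exists>z\<in>Field r. poset_rank r z = 0 \<and> (\<forall>x\<in>Field r. (z, x) \<in> r)"
      using b \<open>poset_rank r b = 0\<close> by blast
    show "\<exists>z\<in>Field r. poset_rank r z = n \<and> (\<forall>x\<in>Field r. (x, z) \<in> r)"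
      using u \<open>poset_rank r u = n\<close> by blast
  qed (simp_all add: poset_rank_less graded_poset_ex_cover[OF gr])
qed

section \<open>Multiplicity-freeness is a bound on the level sizes\<close>

context finite_poset
begin

definition rank_selected :: "nat set \<Rightarrow> 'a set" where
  "rank_selected S = {x \<in> Field r. poset_rank r x \<in> S}"

lemma rank_selected_empty: "rank_selected {} = {}"
  by (simp add: rank_selected_def)

lemma chains_rank_selected:
  "{C \<in> Chains r. C \<subseteq> rank_selected S} = {C \<in> Chains r. poset_rank r ` C \<in> Pow S}"
  using Chains_subset_Field by (fastforce simp: rank_selected_def)

lemma inj_on_poset_rank_Chains:
  assumes "C \<in> Chains r"
  shows "inj_on (poset_rank r) C"
proof (rule inj_onI)
  fix x y assume "x \<in> C" "y \<in> C" "poset_rank r x = poset_rank r y"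
  then show "x = y"
    using Chains_comparable[OF assms] poset_rank_less[of x y] poset_rank_less[of y x] by force
qed

lemma flag_h_eq_signed_chain_count:
  assumes "finite S"
  shows "flag_h r S = (-1) ^ card S * signed_chain_count (rank_selected S)"
proof -
  let ?chains = "{C \<in> Chains r. C \<subseteq> rank_selected S}"
  have "(-1) ^ card (S - T) * int (flag_f r T) =
      (\<Sum>C\<in>{C \<in> ?chains. poset_rank r ` C = T}. (-1) ^ card S * (-1) ^ card C)"
    if T: "T \<in> Pow S" for T
  proof -
    have "card S = card (S - T) + card T"
      using T assms by (simp add: card_Diff_subset card_mono finite_subset)
    then have sign: "(-1) ^ card (S - T) = ((-1) ^ card S * (-1) ^ card T :: int)"
      by (simp add: power_add)
    have "{C \<in> ?chains. poset_rank r ` C = T} = {C \<in> Chains r. poset_rank r ` C = T}"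
      using T unfolding chains_rank_selected by blast
    then have "(-1) ^ card (S - T) * int (flag_f r T) =
        (\<Sum>C\<in>{C \<in> ?chains. poset_rank r ` C = T}. (-1) ^ card S * (-1) ^ card T)"
      using sign by (simp add: flag_f_def)
    also have "\<dots> = (\<Sum>C\<in>{C \<in> ?chains. poset_rank r ` C = T}. (-1) ^ card S * (-1) ^ card C)"
      using card_image[OF inj_on_poset_rank_Chains] by (intro sum.cong HOL.refl) auto
    finally show ?thesis .
  qed
  then have "flag_h r S =
      (\<Sum>T\<in>Pow S. \<Sum>C\<in>{C \<in> ?chains. poset_rank r ` C = T}. (-1) ^ card S * (-1) ^ card C)"
    unfolding flag_h_def by (rule sum.cong[OF HOL.refl])
  also have "\<dots> = (\<Sum>C\<in>?chains. (-1) ^ card S * (-1) ^ card C)"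
    by (rule sum.group) (use assms finite_Chains[OF finite_Field] chains_rank_selected in auto)
  finally show ?thesis by (simp add: signed_chain_count_def sum_distrib_left)
qed

end

context ranked_poset
begin

lemma rank_selected_eq: "rank_selected S = {x \<in> Field r. rk x \<in> S}"
  using poset_rank_eq by (auto simp: rank_selected_def)

lemma rank_selected_insert: "rank_selected (insert m S) = level m \<union> rank_selected S"
  by (auto simp: rank_selected_eq level_def)

lemma signed_chain_count_rank_selected_insert:
  assumes "\<And>s. s \<in> S \<Longrightarrow> m < s"
  shows "signed_chain_count (rank_selected (insert m S)) = signed_chain_count (rank_selected S) -
    (\<Sum>v\<in>level m. signed_chain_count {x \<in> rank_selected S. (v, x) \<in> r})"
  unfolding rank_selected_insert
proof (rule signed_chain_count_minimal_antichain)
  show "level m \<inter> rank_selected S = {}"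
    using assms by (auto simp: rank_selected_eq level_def)
  show "(x, v) \<notin> r" if "v \<in> level m" "x \<in> rank_selected S" for v x
    using that assms[of "rk x"] rk_mono[of x v] by (auto simp: rank_selected_eq level_def)
qed (use finite_level level_antichain in \<open>auto simp: level_def\<close>)

lemma flag_h_singleton: "flag_h r {i} = int (card (level i)) - 1"
proof -
  have "signed_chain_count (rank_selected {i}) = 1 - int (card (level i))"
    using signed_chain_count_rank_selected_insert[of "{}" i]
    by (simp add: rank_selected_empty signed_chain_count_empty)
  then show ?thesis using flag_h_eq_signed_chain_count[of "{i}"] by simp
qed

text \<open>
  If \<open>v\<close> is below just one of the two elements of the lowest level in \<open>S\<close>, that element is a cone
  point of the part above \<open>v\<close>; otherwise \<open>v\<close> is below everything.
\<close>

lemma signed_chain_count_rank_selected_above: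
  assumes "S \<subseteq> {..n}" "\<And>s. s \<in> S \<Longrightarrow> card (level s) \<le> 2"
    and v: "v \<in> Field r" "\<And>s. s \<in> S \<Longrightarrow> rk v < s"
  shows "signed_chain_count {x \<in> rank_selected S. (v, x) \<in> r}
    \<in> {0, signed_chain_count (rank_selected S)}"
proof (cases "S = {}")
  case True
  then show ?thesis by (simp add: rank_selected_empty)
next
  case False
  define m where "m = Min S"
  have "finite S" using assms(1) finite_subset by blast
  then have m: "m \<in> S" "\<And>s. s \<in> S \<Longrightarrow> m \<le> s" using False by (auto simp: m_def)
  have through_m: "\<exists>z\<in>level m. (v, z) \<in> r \<and> (z, x) \<in> r" if "x \<in> rank_selected S" "(v, x) \<in> r" for x
    using interpolate[OF that(2), of m] that(1) v(2)[OF m(1)] m(2) by (auto simp: rank_selected_eq)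
  obtain w where w: "w \<in> level m" "(v, w) \<in> r"
    using ex_above[OF v(1), of m] v(2)[OF m(1)] m(1) assms(1) by (auto simp: subset_iff)
  show ?thesis
  proof (cases "\<forall>z\<in>level m. (v, z) \<in> r")
    case True
    have "(v, x) \<in> r" if "x \<in> rank_selected S" for x
      using that True m(2) ex_below[of x m] trans unfolding rank_selected_eq by blast
    then have "{x \<in> rank_selected S. (v, x) \<in> r} = rank_selected S" by blast
    then show ?thesis by simp
  next
    case False
    then obtain w' where w': "w' \<in> level m" "(v, w') \<notin> r" by blast
    moreover have "w \<noteq> w'" using w(2) w'(2) by blast
    ultimately have "level m = {w, w'}"
      using card_seteq[OF finite_level, of "{w, w'}" m] w assms(2)[OF m(1)] by auto
    then have "(w, x) \<in> r" if "x \<in> rank_selected S" "(v, x) \<in> r" for x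
      using through_m[OF that] w'(2) by auto
    then have "signed_chain_count {x \<in> rank_selected S. (v, x) \<in> r} = 0"
      using w m(1) by (intro signed_chain_count_cone[of w]) (auto simp: rank_selected_eq level_def)
    then show ?thesis by simp
  qed
qed

lemma signed_chain_count_rank_selected:
  assumes "S \<subseteq> {..n}" "\<And>s. s \<in> S \<Longrightarrow> card (level s) \<le> 2"
  shows "signed_chain_count (rank_selected S) \<in> {0, 1, -1}"
  using finite_subset[OF assms(1) finite_atMost] assms
proof (induction S rule: finite_linorder_min_induct)
  case empty
  then show ?case by (simp add: rank_selected_empty signed_chain_count_empty)
next
  case (insert m S)
  let ?e = "signed_chain_count (rank_selected S)"
  let ?above = "\<lambda>v. signed_chain_count {x \<in> rank_selected S. (v, x) \<in> r}"
  have IH: "?e \<in> {0, 1, -1}" using insert by auto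
  define c where "c = card {v \<in> level m. ?above v = ?e}"
  have "?above v = (if ?above v = ?e then ?e else 0)" if "v \<in> level m" for v
    using signed_chain_count_rank_selected_above[of S v] that insert.hyps insert.prems
    by (auto simp: level_def)
  then have "(\<Sum>v\<in>level m. ?above v) = (\<Sum>v\<in>level m. if ?above v = ?e then ?e else 0)"
    by (rule sum.cong[OF HOL.refl])
  also have "\<dots> = int c * ?e"
    using finite_level by (simp add: c_def sum.If_cases Int_def)
  finally have "signed_chain_count (rank_selected (insert m S)) = (1 - int c) * ?e"
    using signed_chain_count_rank_selected_insert[of S m] insert.hyps(2)
    by (simp add: left_diff_distrib)
  moreover have "c \<le> card (level m)" unfolding c_def by (rule card_mono[OF finite_level]) blast
  then have "c \<in> {0, 1, 2}" using insert.prems(2)[of m] by auto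
  ultimately show ?case using IH by auto
qed

lemma flag_h_multiplicity_free_iff:
  "flag_h_multiplicity_free n r \<longleftrightarrow> (\<forall>i. card (level i) \<le> 2)"
proof
  assume mf: "flag_h_multiplicity_free n r"
  show "\<forall>i. card (level i) \<le> 2"
  proof
    fix i
    consider "i = 0" | "i = n" | "n < i" | (interior) "{i} \<subseteq> {1..<n}" by fastforce
    then show "card (level i) \<le> 2"
    proof cases
      case interior
      then have "flag_h r {i} \<in> {0, 1, -1}" using mf by (simp only: flag_h_multiplicity_free_def)
      then show ?thesis by (auto simp: flag_h_singleton)
    qed (use level_0 level_n level_eq_empty_iff[of i] in auto)
  qed
next
  assume two: "\<forall>i. card (level i) \<le> 2"
  show "flag_h_multiplicity_free n r"
    unfolding flag_h_multiplicity_free_def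
  proof (intro allI impI)
    fix S assume S: "S \<subseteq> {1..<n}"
    then have "finite S" using finite_subset by blast
    then have "signed_chain_count (rank_selected S) \<in> {0, 1, -1}"
      using S two by (intro signed_chain_count_rank_selected) auto
    then show "flag_h r S \<in> {0, 1, -1}"
      using flag_h_eq_signed_chain_count[OF \<open>finite S\<close>] by (cases "even (card S)") auto
  qed
qed

end

section \<open>Isomorphisms\<close>

lemma poset_iso_iff_iso: "poset_iso r s \<longleftrightarrow> (\<exists>f. iso r s f)"
  by (simp add: poset_iso_def iso_iff2)

lemma iso_inv_into:
  assumes "iso r s f"
  shows "iso s r (inv_into (Field r) f)"
  unfolding iso_iff2
proof (intro conjI ballI iffI)
  show "bij_betw (inv_into (Field r) f) (Field s) (Field r)"
    using assms by (simp add: iso_def bij_betw_inv_into)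
  fix x y assume "x \<in> Field s" "y \<in> Field s"
  then have "f (inv_into (Field r) f x) = x" "f (inv_into (Field r) f y) = y"
    using iso_Field[OF assms] by (simp_all add: f_inv_into_f)
  then show "(x, y) \<in> s" if "(inv_into (Field r) f x, inv_into (Field r) f y) \<in> r"
    using iso_forward[OF that assms] by simp
qed (rule iso_backward[OF _ assms])

lemma poset_iso_sym: "poset_iso r s \<Longrightarrow> poset_iso s r"
  unfolding poset_iso_iff_iso using iso_inv_into by blast

lemma iso_comp:
  assumes f: "iso r s f" and g: "iso s t g"
  shows "iso r t (g \<circ> f)"
proof -
  have "bij_betw (g \<circ> f) (Field r) (Field t)"
    using f g by (auto simp: iso_def intro: bij_betw_trans)
  moreover have "f x \<in> Field s" if "x \<in> Field r" for x using that iso_Field[OF f] by blast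
  ultimately show ?thesis using f g by (simp add: iso_iff2)
qed

lemma poset_iso_trans: "poset_iso r s \<Longrightarrow> poset_iso s t \<Longrightarrow> poset_iso r t"
  unfolding poset_iso_iff_iso using iso_comp by blast

lemma poset_iso_card: "poset_iso r s \<Longrightarrow> card (Field r) = card (Field s)"
  by (auto simp: poset_iso_def bij_betw_same_card)

lemma iso_dir_image:
  assumes "iso r s f"
  shows "s = dir_image r f"
proof
  show "s \<subseteq> dir_image r f"
  proof
    fix p assume "p \<in> s"
    moreover obtain x y where p: "p = (x, y)" by fastforce
    ultimately have "x \<in> f ` Field r" "y \<in> f ` Field r"
      "(inv_into (Field r) f x, inv_into (Field r) f y) \<in> r"
      using iso_Field[OF assms] iso_backward[OF _ assms] by (auto intro: FieldI1 FieldI2)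
    then show "p \<in> dir_image r f" unfolding p dir_image_def
      by (intro CollectI exI[of _ "inv_into (Field r) f x"] exI[of _ "inv_into (Field r) f y"])
        (simp add: f_inv_into_f)
  qed
qed (use iso_forward[OF _ assms] in \<open>auto simp: dir_image_def\<close>)

lemma Partial_order_iso: "Partial_order r \<Longrightarrow> iso r s f \<Longrightarrow> Partial_order s"
  using iso_dir_image iso_imp_inj_on Partial_order_dir_image by blast

lemma iso_inject: "iso r s f \<Longrightarrow> x \<in> Field r \<Longrightarrow> y \<in> Field r \<Longrightarrow> f x = f y \<longleftrightarrow> x = y"
  using iso_imp_inj_on by (metis inj_on_eq_iff)

lemma ranked_poset_pullback:
  assumes "ranked_poset r n rk" and f: "iso s r f"
  shows "ranked_poset s n (rk \<circ> f)"
proof -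
  interpret ranked_poset r n rk by fact
  have rel_iff: "(x, y) \<in> s \<longleftrightarrow> (f x, f y) \<in> r" if "x \<in> Field s" "y \<in> Field s" for x y
    using f that by (simp add: iso_iff2)
  have onto: "\<exists>x\<in>Field s. z = f x" if "z \<in> Field r" for z
    using that iso_Field[OF f] by blast
  have into: "f x \<in> Field r" if "x \<in> Field s" for x using that iso_Field[OF f] by blast
  show ?thesis
  proof
    show "finite (Field s)" using f finite_Field bij_betw_finite by (auto simp: iso_iff2)
    show "Partial_order s" using partial_order iso_inv_into[OF f] by (rule Partial_order_iso)
    obtain b where "b \<in> Field s" "rk (f b) = 0" "\<forall>x\<in>Field r. (f b, x) \<in> r" using bot onto by metis
    then show "\<exists>z\<in>Field s. (rk \<circ> f) z = 0 \<and> (\<forall>x\<in>Field s. (z, x) \<in> s)"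
      using rel_iff into by auto
    obtain u where "u \<in> Field s" "rk (f u) = n" "\<forall>x\<in>Field r. (x, f u) \<in> r" using top onto by metis
    then show "\<exists>z\<in>Field s. (rk \<circ> f) z = n \<and> (\<forall>x\<in>Field s. (x, z) \<in> s)"
      using rel_iff into by auto
    fix x y assume "(x, y) \<in> s" "x \<noteq> y"
    then have xy: "x \<in> Field s" "y \<in> Field s" by (auto intro: FieldI1 FieldI2)
    then have fxy: "(f x, f y) \<in> r" "f x \<noteq> f y"
      using \<open>(x, y) \<in> s\<close> \<open>x \<noteq> y\<close> rel_iff iso_inject[OF f] by auto
    then show "(rk \<circ> f) x < (rk \<circ> f) y" using rk_less[OF fxy] by simp
    obtain z where z: "(f x, z) \<in> r" "(z, f y) \<in> r" "rk z = Suc (rk (f x))"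
      using ex_cover[OF fxy] by blast
    moreover obtain z' where "z' \<in> Field s" "z = f z'" using onto FieldI1[OF z(2)] by blast
    ultimately show "\<exists>z. (x, z) \<in> s \<and> (z, y) \<in> s \<and> (rk \<circ> f) z = Suc ((rk \<circ> f) x)"
      using rel_iff xy by auto
  qed
qed

lemma rank_iso:
  assumes "ranked_poset r n rk" "ranked_poset s m rk'" "iso r s f" "x \<in> Field r"
  shows "rk' (f x) = rk x"
  using ranked_poset.poset_rank_eq[OF assms(1,4)] assms(4)
    ranked_poset.poset_rank_eq[OF ranked_poset_pullback[OF assms(2,3)]] by simp

lemma ranked_poset_step_hom:
  assumes r: "ranked_poset r n rk" and s: "ranked_poset s m rk'"
    and into: "\<And>x. x \<in> Field r \<Longrightarrow> f x \<in> Field s"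
    and step: "\<And>x y. (x, y) \<in> r \<Longrightarrow> rk y = Suc (rk x) \<Longrightarrow> (f x, f y) \<in> s"
    and xy: "(x, y) \<in> r"
  shows "(f x, f y) \<in> s"
  using xy
proof (induction "rk y - rk x" arbitrary: x rule: less_induct)
  case less
  interpret r: ranked_poset r n rk by fact
  interpret s: ranked_poset s m rk' by fact
  show ?case
  proof (cases "x = y")
    case True
    then show ?thesis using s.refl into FieldI1[OF less.prems] by blast
  next
    case False
    then obtain z where z: "(x, z) \<in> r" "(z, y) \<in> r" "rk z = Suc (rk x)"
      using r.ex_cover less.prems by blast
    have "rk y - rk z < rk y - rk x" using z r.rk_mono[OF z(2)] by simp
    then have "(f z, f y) \<in> s" using less.hyps z(2) by blast
    then show ?thesis using step[OF z(1,3)] s.trans by blast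
  qed
qed

lemma ranked_poset_iso_iff:
  assumes r: "ranked_poset r n rk" and s: "ranked_poset s m rk'"
    and f: "bij_betw f (Field r) (Field s)"
    and rk: "\<And>x. x \<in> Field r \<Longrightarrow> rk' (f x) = rk x"
  shows "iso r s f \<longleftrightarrow>
    (\<forall>x\<in>Field r. \<forall>y\<in>Field r. rk y = Suc (rk x) \<longrightarrow> (x, y) \<in> r \<longleftrightarrow> (f x, f y) \<in> s)"
proof
  assume step: "\<forall>x\<in>Field r. \<forall>y\<in>Field r. rk y = Suc (rk x) \<longrightarrow> (x, y) \<in> r \<longleftrightarrow> (f x, f y) \<in> s"
  let ?g = "inv_into (Field r) f"
  have g: "?g z \<in> Field r" "f (?g z) = z" if "z \<in> Field s" for z
    using that f by (auto simp: bij_betw_def inv_into_into f_inv_into_f)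
  have "(f x, f y) \<in> s" if "(x, y) \<in> r" for x y
    using that
  proof (rule ranked_poset_step_hom[OF r s bij_betwE[OF f, rule_format], rotated -1])
    show "(f x, f y) \<in> s" if "(x, y) \<in> r" "rk y = Suc (rk x)" for x y
      using that step by (meson FieldI1 FieldI2)
  qed
  moreover have "(?g x, ?g y) \<in> r" if "(x, y) \<in> s" for x y
    using that
  proof (rule ranked_poset_step_hom[OF s r g(1), rotated -1])
    fix x y assume xy: "(x, y) \<in> s" "rk' y = Suc (rk' x)"
    then have "x \<in> Field s" "y \<in> Field s" by (auto intro: FieldI1 FieldI2)
    then show "(?g x, ?g y) \<in> r"
      using xy g step rk[of "?g x"] rk[of "?g y"] by simp
  qed
  ultimately show "iso r s f"
    unfolding iso_iff2 using f bij_betw_inv_into_left[OF f] by metis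
qed (simp add: iso_iff2)

section \<open>The poset generated by relations between consecutive levels\<close>

definition generated_order :: "'a set \<Rightarrow> 'a rel \<Rightarrow> 'a rel" where
  "generated_order V E = E\<^sup>* \<inter> V \<times> V"

lemma Field_generated_order: "Field (generated_order V E) = V"
  by (auto simp: generated_order_def Field_def)

locale level_digraph =
  fixes V :: "'a set" and E :: "'a rel" and n :: nat and rk :: "'a \<Rightarrow> nat" and b u :: 'a
  assumes finite_V: "finite V"
    and E_subset: "E \<subseteq> V \<times> V"
    and E_rk: "(x, y) \<in> E \<Longrightarrow> rk y = Suc (rk x)"
    and bottom: "b \<in> V" "rk b = 0" and top: "u \<in> V" "rk u = n"
    and ex_pred: "y \<in> V \<Longrightarrow> y \<noteq> b \<Longrightarrow> \<exists>x. (x, y) \<in> E"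
    and ex_succ: "x \<in> V \<Longrightarrow> x \<noteq> u \<Longrightarrow> \<exists>y. (x, y) \<in> E"
begin

lemma rtrancl_rk_less:
  assumes "(x, y) \<in> E\<^sup>*"
  shows "x = y \<or> rk x < rk y"
  using assms by (induction rule: rtrancl_induct) (auto dest: E_rk)

lemma generated_order_step_iff:
  assumes "rk y = Suc (rk x)"
  shows "(x, y) \<in> generated_order V E \<longleftrightarrow> (x, y) \<in> E"
proof
  assume "(x, y) \<in> generated_order V E"
  moreover have "x \<noteq> y" using assms by auto
  ultimately obtain z where z: "(x, z) \<in> E" "(z, y) \<in> E\<^sup>*"
    unfolding generated_order_def by (metis IntD1 converse_rtranclE)
  then have "z = y" using E_rk[OF z(1)] rtrancl_rk_less[OF z(2)] assms by auto
  then show "(x, y) \<in> E" using z(1) by simp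
qed (use E_subset in \<open>auto simp: generated_order_def\<close>)

lemma bottom_below:
  assumes "x \<in> V"
  shows "(b, x) \<in> E\<^sup>*"
  using assms
proof (induction "rk x" arbitrary: x rule: less_induct)
  case less
  show ?case
  proof (cases "x = b")
    case False
    then obtain w where w: "(w, x) \<in> E" using ex_pred less.prems by blast
    then have "(b, w) \<in> E\<^sup>*" using less.hyps[of w] E_rk[OF w] E_subset by auto
    then show ?thesis using w by (rule rtrancl_into_rtrancl)
  qed simp
qed

lemma top_above:
  assumes "x \<in> V"
  shows "(x, u) \<in> E\<^sup>*"
  using assms
proof (induction "Max (rk ` V) - rk x" arbitrary: x rule: less_induct)
  case less
  show ?case
  proof (cases "x = u")
    case False
    then obtain y where y: "(x, y) \<in> E" using ex_succ less.prems by blast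
    then have "y \<in> V" "rk y = Suc (rk x)" using E_subset E_rk by auto
    moreover have "rk y \<le> Max (rk ` V)" using \<open>y \<in> V\<close> finite_V by simp
    ultimately have "(y, u) \<in> E\<^sup>*" using less.hyps[of y] by simp
    then show ?thesis using y by (rule converse_rtrancl_into_rtrancl[rotated])
  qed simp
qed

lemma Partial_order_generated_order: "Partial_order (generated_order V E)"
proof -
  have "antisym (generated_order V E)"
    by (rule antisymI) (use rtrancl_rk_less in \<open>unfold generated_order_def, blast dest: less_asym\<close>)
  moreover have "trans (generated_order V E)" by (rule transI) (auto simp: generated_order_def)
  moreover have "refl_on V (generated_order V E)" by (auto simp: refl_on_def generated_order_def)
  moreover have "generated_order V E \<subseteq> V \<times> V" by (auto simp: generated_order_def)
  ultimately show ?thesis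
    by (simp add: partial_order_on_def preorder_on_def Field_generated_order)
qed

lemma ranked_poset_generated_order: "ranked_poset (generated_order V E) n rk"
proof
  show "finite (Field (generated_order V E))" by (simp add: Field_generated_order finite_V)
  show "\<exists>z\<in>Field (generated_order V E). rk z = 0 \<and>
      (\<forall>x\<in>Field (generated_order V E). (z, x) \<in> generated_order V E)"
    unfolding Field_generated_order using bottom bottom_below by (auto simp: generated_order_def)
  show "\<exists>z\<in>Field (generated_order V E). rk z = n \<and>
      (\<forall>x\<in>Field (generated_order V E). (x, z) \<in> generated_order V E)"
    unfolding Field_generated_order using top top_above by (auto simp: generated_order_def)
  fix x y assume xy: "(x, y) \<in> generated_order V E" "x \<noteq> y"
  then show "rk x < rk y" using rtrancl_rk_less by (auto simp: generated_order_def)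
  obtain z where "(x, z) \<in> E" "(z, y) \<in> E\<^sup>*"
    using xy unfolding generated_order_def by (metis IntD1 converse_rtranclE)
  then show "\<exists>z. (x, z) \<in> generated_order V E \<and> (z, y) \<in> generated_order V E \<and> rk z = Suc (rk x)"
    using xy(1) E_rk E_subset by (intro exI[of _ z]) (auto simp: generated_order_def)
qed (fact Partial_order_generated_order)

end

section \<open>Narrow posets\<close>

locale narrow_poset = ranked_poset +
  assumes card_level_le: "card (level i) \<le> 2"

definition narrow :: "nat \<Rightarrow> 'a rel \<Rightarrow> bool" where
  "narrow n r \<longleftrightarrow> (\<exists>rk. narrow_poset r n rk)"

lemma narrow_poset_pullback:
  assumes "narrow_poset r n rk" and f: "iso s r f"
  shows "narrow_poset s n (rk \<circ> f)"
proof -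
  interpret r: narrow_poset r n rk by fact
  interpret s: ranked_poset s n "rk \<circ> f"
    using r.ranked_poset_axioms f by (rule ranked_poset_pullback)
  show ?thesis
  proof
    fix i
    have "f ` s.level i \<subseteq> r.level i"
      using iso_Field[OF f] by (auto simp: s.level_def r.level_def)
    moreover have "inj_on f (s.level i)"
      using iso_imp_inj_on[OF f] by (auto simp: s.level_def inj_on_def)
    ultimately have "card (s.level i) \<le> card (r.level i)"
      using r.finite_level card_inj_on_le by blast
    then show "card (s.level i) \<le> 2" using r.card_level_le[of i] by simp
  qed
qed

lemma narrow_poset_iso: "narrow n r \<Longrightarrow> poset_iso s r \<Longrightarrow> narrow n s"
  unfolding narrow_def poset_iso_iff_iso using narrow_poset_pullback by blast

lemma narrow_iff:
  "narrow n r \<longleftrightarrow> graded_poset n r \<and> has_bot r \<and> has_top r \<and> flag_h_multiplicity_free n r"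
proof
  assume "narrow n r"
  then obtain rk where "narrow_poset r n rk" by (auto simp: narrow_def)
  then interpret narrow_poset r n rk .
  show "graded_poset n r \<and> has_bot r \<and> has_top r \<and> flag_h_multiplicity_free n r"
    using graded has_bot has_top flag_h_multiplicity_free_iff card_level_le by blast
next
  assume r: "graded_poset n r \<and> has_bot r \<and> has_top r \<and> flag_h_multiplicity_free n r"
  then interpret ranked_poset r n "poset_rank r" by (intro graded_poset_imp_ranked_poset) auto
  have "narrow_poset r n (poset_rank r)"
    using r flag_h_multiplicity_free_iff by unfold_locales blast
  then show "narrow n r" by (auto simp: narrow_def)
qed

lemma mf_posets_eq: "mf_posets n k = {r. Field r = {..<k} \<and> narrow n r}"
  by (simp add: mf_posets_def narrow_iff)

section \<open>Words describing narrow posets\<close>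

text \<open>
  A letter describes a level and its relation to the level below: \<open>Point\<close> is a level with a single
  element, the other letters stand for two elements, labelled by truth values, which are related to
  the level below completely (\<open>Full\<close>), by a matching, or by all pairs but one (\<open>Up\<close>, \<open>Down\<close>).
  Swapping both labels of every level back to the last \<open>Point\<close> or \<open>Full\<close> does not change the
  isomorphism type. This freedom is used to make the first letter after that which is not a matching
  an \<open>Up\<close>; matchings are written \<open>Free_Match\<close> before this happens and \<open>Rigid_Match\<close> after.
\<close>

datatype letter = Point | Full | Free_Match | Rigid_Match | Up | Down

fun edge :: "letter \<Rightarrow> bool \<Rightarrow> bool \<Rightarrow> bool" where
  "edge Point a b = True"
| "edge Full a b = True"
| "edge Free_Match a b = (a = b)"
| "edge Rigid_Match a b = (a = b)"
| "edge Up a b = (a \<longrightarrow> b)"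
| "edge Down a b = (b \<longrightarrow> a)"

fun labels :: "letter \<Rightarrow> bool set" where
  "labels Point = {False}"
| "labels _ = UNIV"

fun swappable :: "letter \<Rightarrow> bool" where
  "swappable Full = True"
| "swappable Free_Match = True"
| "swappable _ = False"

fun rigid :: "letter \<Rightarrow> bool" where
  "rigid Rigid_Match = True"
| "rigid Up = True"
| "rigid Down = True"
| "rigid _ = False"

fun transition :: "letter \<Rightarrow> letter \<Rightarrow> bool" where
  "transition d Point = True"
| "transition d Full = True"
| "transition d Free_Match = swappable d"
| "transition d Rigid_Match = rigid d"
| "transition d Up = (d \<noteq> Point)"
| "transition d Down = rigid d"

lemma UNIV_letter: "UNIV = {Point, Full, Free_Match, Rigid_Match, Up, Down}"
  using letter.exhaust by auto

instance letter :: finite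
  by standard (simp add: UNIV_letter)

lemma transition_ex_below: "transition d c \<Longrightarrow> b \<in> labels c \<Longrightarrow> \<exists>a\<in>labels d. edge c a b"
  by (cases c; cases b; cases d) auto

lemma transition_ex_above: "transition d c \<Longrightarrow> a \<in> labels d \<Longrightarrow> \<exists>b\<in>labels c. edge c a b"
  by (cases c; cases a; cases d) auto

lemma letter_unique_up_to_swaps:
  assumes "transition d c" "transition d c'" "labels c = labels c'"
    and "s \<longrightarrow> swappable d" "t \<longrightarrow> labels c = UNIV"
    and edges: "\<And>a b. a \<in> labels d \<Longrightarrow> b \<in> labels c \<Longrightarrow> edge c a b \<longleftrightarrow> edge c' (a \<noteq> s) (b \<noteq> t)"
  shows "c = c' \<and> (t \<longrightarrow> swappable c)"
proof (cases "d = Point")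
  case True
  then show ?thesis using assms(1-5) by (cases c; cases c') auto
next
  case False
  then have "labels d = UNIV" by (cases d) auto
  moreover have "\<not> (swappable d \<and> rigid d)" by (cases d) auto
  ultimately show ?thesis
    using assms(1-5) edges[of True True] edges[of True False]
      edges[of False True] edges[of False False]
    by (cases c; cases c'; cases s; cases t) auto
qed

lemma total_bool_relation_cases:
  fixes E :: "bool \<Rightarrow> bool \<Rightarrow> bool"
  assumes "\<And>a. \<exists>b. E a b" "\<And>b. \<exists>a. E a b"
  obtains (full) "\<And>a b. E a b"
    | (matching) m where "\<And>a b. E a b \<longleftrightarrow> (a = b) \<noteq> m"
    | (all_but_one) p q where "\<And>a b. E a b \<longleftrightarrow> a \<noteq> p \<or> b \<noteq> q"
proof -
  consider (complete) "\<And>a b. E a b" | (missing) p q where "\<not> E p q" by blast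
  then show ?thesis
  proof cases
    case (missing p q)
    obtain a b where "E a q" "E p b" using assms by blast
    then have others: "E (\<not> p) q" "E p (\<not> q)"
      using missing by (cases a; cases b; cases p; cases q; simp)+
    show ?thesis
    proof (cases "E (\<not> p) (\<not> q)")
      case True
      have "E a b \<longleftrightarrow> a \<noteq> p \<or> b \<noteq> q" for a b
        using missing others True by (cases "a = p"; cases "b = q") auto
      then show ?thesis by (rule all_but_one)
    next
      case False
      have "E a b \<longleftrightarrow> (a = b) \<noteq> (p = q)" for a b
        using missing others False by (cases "a = p"; cases "b = q") auto
      then show ?thesis by (rule matching)
    qed
  qed (rule full)
qed

text \<open>
  The letter \<open>c\<close> above \<open>d\<close> describes \<open>E\<close> after relabelling: if the upper labels may still be swapped
  afterwards (\<open>t\<close>), then a permitted swap \<open>s\<close> of the lower labels compensates for it.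
\<close>

definition describes :: "letter \<Rightarrow> letter \<Rightarrow> bool \<Rightarrow> (bool \<Rightarrow> bool \<Rightarrow> bool) \<Rightarrow> bool" where
  "describes d c t\<^sub>0 E \<longleftrightarrow> transition d c \<and> (\<forall>t. (t \<longrightarrow> swappable c) \<longrightarrow>
     (\<exists>s. (s \<longrightarrow> swappable d) \<and>
       (\<forall>a\<in>labels d. \<forall>b\<in>labels c. E a b \<longleftrightarrow> edge c (a \<noteq> s) ((b \<noteq> t\<^sub>0) \<noteq> t))))"

lemma describesI:
  assumes "transition d c"
    and "\<And>t. (t \<longrightarrow> swappable c) \<Longrightarrow> \<exists>s. (s \<longrightarrow> swappable d) \<and>
      (\<forall>a b. E a b \<longleftrightarrow> edge c (a \<noteq> s) ((b \<noteq> t\<^sub>0) \<noteq> t))"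
  shows "describes d c t\<^sub>0 E"
  unfolding describes_def
proof (intro conjI allI impI)
  fix t assume "t \<longrightarrow> swappable c"
  from assms(2)[OF this] obtain s where "s \<longrightarrow> swappable d"
    "\<forall>a b. E a b \<longleftrightarrow> edge c (a \<noteq> s) ((b \<noteq> t\<^sub>0) \<noteq> t)" by (elim exE conjE)
  then show "\<exists>s. (s \<longrightarrow> swappable d) \<and>
      (\<forall>a\<in>labels d. \<forall>b\<in>labels c. E a b \<longleftrightarrow> edge c (a \<noteq> s) ((b \<noteq> t\<^sub>0) \<noteq> t))"
    by (intro exI[of _ s] conjI ballI) simp_all
qed (fact assms(1))

lemma describesE:
  assumes "describes d c t\<^sub>0 E" "t \<longrightarrow> swappable c"
  obtains s where "s \<longrightarrow> swappable d"
    "\<forall>a\<in>labels d. \<forall>b\<in>labels c. E a b \<longleftrightarrow> edge c (a \<noteq> s) ((b \<noteq> t\<^sub>0) \<noteq> t)"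
  using assms(1)[unfolded describes_def, THEN conjunct2, THEN spec, THEN mp, OF assms(2)]
  by (elim exE conjE)

lemma ex_describes_matching:
  assumes d: "d \<noteq> Point" and E: "\<And>a b. E a b \<longleftrightarrow> (a = b) \<noteq> m"
  shows "\<exists>c t\<^sub>0. c \<noteq> Point \<and> describes d c t\<^sub>0 E"
proof (cases "swappable d")
  case True
  have "\<exists>s. \<forall>a b. E a b \<longleftrightarrow> edge Free_Match (a \<noteq> s) ((b \<noteq> False) \<noteq> t)" for t
    using E by (intro exI[of _ "m \<noteq> t"]) auto
  then have "describes d Free_Match False E" using True by (intro describesI) simp_all
  then show ?thesis by blast
next
  case False
  then have "rigid d" using d by (cases d) auto
  moreover have "\<forall>a b. E a b \<longleftrightarrow> edge Rigid_Match (a \<noteq> False) ((b \<noteq> m) \<noteq> False)"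
    using E by auto
  ultimately have "describes d Rigid_Match m E" by (intro describesI) auto
  then show ?thesis by blast
qed

lemma ex_describes_all_but_one:
  assumes d: "d \<noteq> Point" and E: "\<And>a b. E a b \<longleftrightarrow> a \<noteq> p \<or> b \<noteq> q"
  shows "\<exists>c t\<^sub>0. c \<noteq> Point \<and> describes d c t\<^sub>0 E"
proof -
  consider (up) "p \<or> swappable d" | (down) "\<not> p" "rigid d" using d by (cases d) auto
  then show ?thesis
  proof cases
    case up
    have "\<forall>a b. E a b \<longleftrightarrow> edge Up (a \<noteq> (\<not> p)) ((b \<noteq> q) \<noteq> False)" using E by auto
    then have "describes d Up q E"
      using d up by (intro describesI exI[of _ "\<not> p"]) (auto simp del: edge.simps)
    then show ?thesis by blast
  next
    case down
    have "\<forall>a b. E a b \<longleftrightarrow> edge Down (a \<noteq> False) ((b \<noteq> (\<not> q)) \<noteq> False)"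
      using E down(1) by auto
    then have "describes d Down (\<not> q) E"
      using down(2) by (intro describesI exI[of _ False]) (auto simp del: edge.simps)
    then show ?thesis by blast
  qed
qed

lemma ex_describes_above_pair:
  assumes d: "d \<noteq> Point" and total: "\<And>a. \<exists>b. E a b" "\<And>b. \<exists>a. E a b"
  shows "\<exists>c t\<^sub>0. c \<noteq> Point \<and> describes d c t\<^sub>0 E"
  using total
proof (cases rule: total_bool_relation_cases)
  case full
  then have "describes d Full False E" by (intro describesI) auto
  then show ?thesis by blast
next
  case matching
  with d show ?thesis by (rule ex_describes_matching)
next
  case all_but_one
  with d show ?thesis by (rule ex_describes_all_but_one)
qed

lemma ex_describes:
  assumes L: "L \<in> {{False}, UNIV}"
    and above: "\<forall>a\<in>labels d. \<exists>b\<in>L. E a b" and below: "\<forall>b\<in>L. \<exists>a\<in>labels d. E a b"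
  shows "\<exists>c t\<^sub>0. labels c = L \<and> (t\<^sub>0 \<longrightarrow> L = UNIV) \<and> describes d c t\<^sub>0 E"
proof -
  consider (point) "L = {False}" | (above_point) "L = UNIV" "d = Point"
    | (above_pair) "L = UNIV" "d \<noteq> Point" "labels d = UNIV"
    using L by (cases d) auto
  then show ?thesis
  proof cases
    case point
    then have "describes d Point False E" using above by (auto simp: describes_def)
    then show ?thesis using point by (intro exI[of _ Point] exI[of _ False]) simp
  next
    case above_point
    then have "describes d Full False E" using below by (auto simp: describes_def)
    then show ?thesis using above_point by (intro exI[of _ Full] exI[of _ False]) simp
  next
    case above_pair
    then obtain c t\<^sub>0 where "c \<noteq> Point" "describes d c t\<^sub>0 E"
      using ex_describes_above_pair[of d E] above below by auto
    moreover have "labels c = UNIV" using \<open>c \<noteq> Point\<close> by (cases c) auto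
    ultimately show ?thesis using above_pair(1) by blast
  qed
qed

definition words :: "nat \<Rightarrow> letter \<Rightarrow> letter list set" where
  "words n c = {w. length w = Suc n \<and> hd w = Point \<and> last w = c \<and> successively transition w}"

lemma words_nth:
  assumes "w \<in> words n c"
  shows "length w = Suc n" "w ! 0 = Point" "w ! n = c"
    and "i < n \<Longrightarrow> transition (w ! i) (w ! Suc i)"
proof -
  have "w \<noteq> []" using assms by (auto simp: words_def)
  then show "length w = Suc n" "w ! 0 = Point" "w ! n = c"
    using assms by (auto simp: words_def hd_conv_nth last_conv_nth)
  show "transition (w ! i) (w ! Suc i)" if "i < n"
    using assms that by (auto simp: words_def successively_conv_nth)
qed

lemma words_0: "words 0 c = (if c = Point then {[Point]} else {})"
  by (auto simp: words_def length_Suc_conv)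

lemma snoc_in_words: "w \<in> words n d \<Longrightarrow> transition d c \<Longrightarrow> w @ [c] \<in> words (Suc n) c"
  by (auto simp: words_def successively_append_iff hd_append)

lemma words_Suc: "words (Suc n) c = (\<Union>d\<in>{d. transition d c}. (\<lambda>w. w @ [c]) ` words n d)"
proof (intro equalityI subsetI)
  fix w assume w: "w \<in> words (Suc n) c"
  then have "w \<noteq> []" by (auto simp: words_def)
  then obtain v c' where v: "w = v @ [c']" by (metis rev_exhaust)
  then have "c' = c" "v \<noteq> []" using w by (auto simp: words_def)
  then have "v \<in> words n (last v)" "transition (last v) c"
    using w v by (auto simp: words_def successively_append_iff)
  then show "w \<in> (\<Union>d\<in>{d. transition d c}. (\<lambda>w. w @ [c]) ` words n d)"
    using v \<open>c' = c\<close> by blast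
qed (auto intro: snoc_in_words)

definition word_carrier :: "letter list \<Rightarrow> (nat \<times> bool) set" where
  "word_carrier w = Sigma {..<length w} (\<lambda>i. labels (w ! i))"

definition word_steps :: "letter list \<Rightarrow> (nat \<times> bool) rel" where
  "word_steps w = {(p, q). p \<in> word_carrier w \<and> q \<in> word_carrier w \<and>
    fst q = Suc (fst p) \<and> edge (w ! fst q) (snd p) (snd q)}"

definition word_poset :: "letter list \<Rightarrow> (nat \<times> bool) rel" where
  "word_poset w = generated_order (word_carrier w) (word_steps w)"

lemma Field_word_poset: "Field (word_poset w) = word_carrier w"
  by (simp add: word_poset_def Field_generated_order)

lemma finite_word_carrier: "finite (word_carrier w)"
  by (simp add: word_carrier_def)

lemma level_digraph_word:
  assumes w: "w \<in> words n Point"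
  shows "level_digraph (word_carrier w) (word_steps w) n fst (0, False) (n, False)"
proof
  note w_nth = words_nth[OF w]
  show "(0, False) \<in> word_carrier w" "(n, False) \<in> word_carrier w"
    using w_nth by (auto simp: word_carrier_def)
  show "\<exists>p. (p, q) \<in> word_steps w" if q: "q \<in> word_carrier w" "q \<noteq> (0, False)" for q
  proof (cases q)
    case (Pair j b)
    then obtain i where i: "j = Suc i" "i < n" "b \<in> labels (w ! j)"
      using q w_nth by (cases j) (auto simp: word_carrier_def)
    then obtain a where "a \<in> labels (w ! i)" "edge (w ! j) a b"
      using transition_ex_below w_nth(4) by blast
    then have "((i, a), q) \<in> word_steps w"
      using i w_nth(1) by (simp add: word_steps_def word_carrier_def Pair)
    then show ?thesis ..
  qed
  show "\<exists>q. (p, q) \<in> word_steps w" if p: "p \<in> word_carrier w" "p \<noteq> (n, False)" for p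
  proof (cases p)
    case (Pair i a)
    then have i: "i < n" "a \<in> labels (w ! i)"
      using p w_nth by (auto simp: word_carrier_def less_Suc_eq)
    then obtain b where "b \<in> labels (w ! Suc i)" "edge (w ! Suc i) a b"
      using transition_ex_above w_nth(4) by blast
    then have "(p, (Suc i, b)) \<in> word_steps w"
      using i w_nth(1) by (simp add: word_steps_def word_carrier_def Pair)
    then show ?thesis ..
  qed
qed (auto simp: finite_word_carrier word_steps_def)

lemma narrow_word_poset:
  assumes "w \<in> words n Point"
  shows "narrow_poset (word_poset w) n fst"
proof -
  interpret level_digraph "word_carrier w" "word_steps w" n fst "(0, False)" "(n, False)"
    using assms by (rule level_digraph_word)
  interpret ranked_poset "word_poset w" n fst
    unfolding word_poset_def by (rule ranked_poset_generated_order)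
  show ?thesis
  proof
    fix i
    have "level i \<subseteq> {i} \<times> UNIV" by (auto simp: level_def)
    then have "card (level i) \<le> card ({i} \<times> (UNIV :: bool set))" by (intro card_mono) auto
    then show "card (level i) \<le> 2" by simp
  qed
qed

lemma word_poset_step_iff:
  assumes "w \<in> words n Point" "(i, a) \<in> word_carrier w" "(Suc i, b) \<in> word_carrier w"
  shows "((i, a), (Suc i, b)) \<in> word_poset w \<longleftrightarrow> edge (w ! Suc i) a b"
proof -
  interpret level_digraph "word_carrier w" "word_steps w" n fst "(0, False)" "(n, False)"
    using assms(1) by (rule level_digraph_word)
  show ?thesis
    using generated_order_step_iff[of "(Suc i, b)" "(i, a)"] assms(2,3)
    by (simp add: word_poset_def word_steps_def)
qed

lemma bij_betw_bool_unique_up_to_swap: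
  fixes f g :: "'a \<Rightarrow> bool"
  assumes f: "bij_betw f A B" and g: "bij_betw g A B"
  shows "\<exists>s. (s \<longrightarrow> B = UNIV) \<and> (\<forall>x\<in>A. g x \<longleftrightarrow> f x \<noteq> s)"
proof (cases "\<forall>x\<in>A. g x = f x")
  case False
  then obtain a where a: "a \<in> A" "g a \<noteq> f a" by blast
  have "{f a, g a} \<subseteq> B" using a(1) bij_betwE[OF f] bij_betwE[OF g] by blast
  then have "B = UNIV" using a(2) by (cases "f a"; cases "g a") (auto simp: UNIV_bool)
  moreover have "g x \<longleftrightarrow> f x \<noteq> True" if "x \<in> A" for x
  proof (cases "x = a")
    case False
    then have "f x \<noteq> f a" "g x \<noteq> g a"
      using inj_on_eq_iff[OF bij_betw_imp_inj_on[OF f] that a(1)]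
        inj_on_eq_iff[OF bij_betw_imp_inj_on[OF g] that a(1)] by simp_all
    then show ?thesis using a(2) by argo
  qed (use a(2) in simp)
  ultimately show ?thesis by blast
qed (intro exI[of _ False], simp)

lemma bij_betw_bool_swap:
  fixes f :: "'a \<Rightarrow> bool"
  assumes "bij_betw f A B" "s \<longrightarrow> B = UNIV"
  shows "bij_betw (\<lambda>x. f x \<noteq> s) A B"
proof (cases s)
  case True
  then have "bij_betw Not B B" using assms(2) by (auto simp: bij_betw_def inj_on_def surj_def)
  then show ?thesis using bij_betw_trans[OF assms(1)] True by (simp add: o_def)
qed (use assms(1) in simp)

lemma bij_betw_Pair_Sigma:
  assumes "\<And>x. x \<in> A \<Longrightarrow> g x \<in> I"
  shows "bij_betw (\<lambda>x. (g x, f x)) A (Sigma I B) \<longleftrightarrow>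
    (\<forall>i\<in>I. bij_betw f {x \<in> A. g x = i} (B i))"
proof
  assume bij: "bij_betw (\<lambda>x. (g x, f x)) A (Sigma I B)"
  show "\<forall>i\<in>I. bij_betw f {x \<in> A. g x = i} (B i)"
  proof
    fix i assume "i \<in> I"
    have "inj_on f {x \<in> A. g x = i}" using bij by (auto simp: bij_betw_def inj_on_def)
    moreover have "b \<in> f ` {x \<in> A. g x = i}" if "b \<in> B i" for b
    proof -
      have "(i, b) \<in> (\<lambda>x. (g x, f x)) ` A"
        using bij_betw_imp_surj_on[OF bij] \<open>i \<in> I\<close> that by simp
      then show ?thesis by auto
    qed
    ultimately show "bij_betw f {x \<in> A. g x = i} (B i)"
      using bij_betwE[OF bij] by (auto simp: bij_betw_def)
  qed
next
  assume fibre: "\<forall>i\<in>I. bij_betw f {x \<in> A. g x = i} (B i)"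
  have "inj_on (\<lambda>x. (g x, f x)) A"
  proof (rule inj_onI)
    fix x y assume "x \<in> A" "y \<in> A" "(g x, f x) = (g y, f y)"
    then show "x = y" using fibre assms[of x] by (auto simp: bij_betw_def inj_on_def)
  qed
  moreover have "(g x, f x) \<in> Sigma I B" if "x \<in> A" for x
    using that assms[OF that] bij_betwE fibre by fastforce
  moreover have "p \<in> (\<lambda>x. (g x, f x)) ` A" if mem: "p \<in> Sigma I B" for p
  proof -
    obtain i b where p: "p = (i, b)" "i \<in> I" "b \<in> B i" using mem by blast
    then have "b \<in> f ` {x \<in> A. g x = i}" using bij_betw_imp_surj_on fibre by blast
    then show ?thesis using p(1) by auto
  qed
  ultimately show "bij_betw (\<lambda>x. (g x, f x)) A (Sigma I B)" by (auto simp: bij_betw_def)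
qed

context ranked_poset
begin

definition labelling :: "('a \<Rightarrow> bool) \<Rightarrow> letter list \<Rightarrow> bool" where
  "labelling l w \<longleftrightarrow> (\<forall>i<length w. bij_betw l (level i) (labels (w ! i))) \<and>
     (\<forall>x\<in>Field r. \<forall>y\<in>Field r. rk y = Suc (rk x) \<and> rk y < length w \<longrightarrow>
        (x, y) \<in> r \<longleftrightarrow> edge (w ! rk y) (l x) (l y))"

lemma labelling_bij: "labelling l w \<Longrightarrow> i < length w \<Longrightarrow> bij_betw l (level i) (labels (w ! i))"
  by (simp add: labelling_def)

lemma labelling_edge:
  assumes "labelling l w" "x \<in> level i" "y \<in> level (Suc i)" "Suc i < length w"
  shows "(x, y) \<in> r \<longleftrightarrow> edge (w ! Suc i) (l x) (l y)"
  using assms by (auto simp: labelling_def level_def)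

lemma labelling_iff_iso:
  assumes w: "w \<in> words n Point"
  shows "labelling l w \<longleftrightarrow> iso r (word_poset w) (\<lambda>x. (rk x, l x))"
proof -
  let ?f = "\<lambda>x. (rk x, l x)"
  interpret word: narrow_poset "word_poset w" n fst using w by (rule narrow_word_poset)
  note length_w = words_nth(1)[OF w]
  have rk: "rk x < length w" if "x \<in> Field r" for x using rk_le_n[OF that] length_w by simp
  have bij_iff: "bij_betw ?f (Field r) (Field (word_poset w)) \<longleftrightarrow>
      (\<forall>i<length w. bij_betw l (level i) (labels (w ! i)))"
    unfolding Field_word_poset word_carrier_def
    using bij_betw_Pair_Sigma[of "Field r" rk "{..<length w}" l "\<lambda>i. labels (w ! i)"] rk
    by (simp add: level_def Ball_def)
  have iso_iff: "iso r (word_poset w) ?f \<longleftrightarrow> (\<forall>x\<in>Field r. \<forall>y\<in>Field r. rk y = Suc (rk x) \<longrightarrow>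
      (x, y) \<in> r \<longleftrightarrow> edge (w ! rk y) (l x) (l y))"
    if bij: "bij_betw ?f (Field r) (Field (word_poset w))"
  proof -
    have "(?f x, ?f y) \<in> word_poset w \<longleftrightarrow> edge (w ! rk y) (l x) (l y)"
      if xy: "x \<in> Field r" "y \<in> Field r" "rk y = Suc (rk x)" for x y
    proof -
      have "?f x \<in> word_carrier w" "?f y \<in> word_carrier w"
        using xy(1,2) bij_betwE[OF bij] by (simp_all add: Field_word_poset)
      then show ?thesis using word_poset_step_iff[OF w] xy(3) by simp
    qed
    then show ?thesis
      using ranked_poset_iso_iff[OF ranked_poset_axioms word.ranked_poset_axioms bij] by simp
  qed
  moreover have "bij_betw ?f (Field r) (Field (word_poset w))" if "iso r (word_poset w) ?f"
    using that by (simp add: iso_def)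
  ultimately show ?thesis unfolding labelling_def bij_iff[symmetric] using rk by blast
qed

lemma poset_iso_word_poset_iff:
  assumes w: "w \<in> words n Point"
  shows "poset_iso r (word_poset w) \<longleftrightarrow> (\<exists>l. labelling l w)"
proof
  interpret word: narrow_poset "word_poset w" n fst using w by (rule narrow_word_poset)
  assume "poset_iso r (word_poset w)"
  then obtain f where f: "iso r (word_poset w) f" by (auto simp: poset_iso_iff_iso)
  have "fst (f x) = rk x" if "x \<in> Field r" for x
    using ranked_poset_axioms word.ranked_poset_axioms f that by (rule rank_iso)
  then have "f x = (rk x, snd (f x))" if "x \<in> Field r" for x using that by (metis prod.collapse)
  then have "iso r (word_poset w) (\<lambda>x. (rk x, snd (f x)))"
    using f unfolding iso_iff2 by (auto cong: bij_betw_cong)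
  then show "\<exists>l. labelling l w"
    using labelling_iff_iso[OF w, of "\<lambda>x. snd (f x)"] by blast
qed (auto simp: labelling_iff_iso[OF w] poset_iso_iff_iso)

lemma labelling_unique_Suc:
  assumes l: "labelling l w" "Suc i < length w" and l': "labelling l' w'" "Suc i < length w'"
    and same: "w ! i = w' ! i"
    and trans: "transition (w ! i) (w ! Suc i)" "transition (w' ! i) (w' ! Suc i)"
    and s: "s \<longrightarrow> swappable (w ! i)" "\<forall>x\<in>level i. l' x \<longleftrightarrow> l x \<noteq> s"
  shows "w ! Suc i = w' ! Suc i \<and>
    (\<exists>t. (t \<longrightarrow> swappable (w ! Suc i)) \<and> (\<forall>y\<in>level (Suc i). l' y \<longleftrightarrow> l y \<noteq> t))"
proof -
  let ?c = "w ! Suc i" and ?c' = "w' ! Suc i"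
  have bij: "bij_betw l (level i) (labels (w ! i))" "bij_betw l (level (Suc i)) (labels ?c)"
    "bij_betw l' (level (Suc i)) (labels ?c')" using labelling_bij l l' by simp_all
  have "card (labels ?c) = card (labels ?c')" using bij(2,3) by (metis bij_betw_same_card)
  then have labels: "labels ?c = labels ?c'" by (cases ?c; cases ?c') auto
  with bij(3) have "bij_betw l' (level (Suc i)) (labels ?c)" by simp
  from bij_betw_bool_unique_up_to_swap[OF bij(2) this]
  obtain t where t: "t \<longrightarrow> labels ?c = UNIV" "\<forall>y\<in>level (Suc i). l' y \<longleftrightarrow> l y \<noteq> t"
    by (elim exE conjE)
  have "edge ?c a b \<longleftrightarrow> edge ?c' (a \<noteq> s) (b \<noteq> t)"
    if ab: "a \<in> labels (w ! i)" "b \<in> labels ?c" for a b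
  proof -
    obtain x where x: "x \<in> level i" "l x = a" using bij(1) ab(1) by (auto simp: bij_betw_def)
    obtain y where y: "y \<in> level (Suc i)" "l y = b" using bij(2) ab(2) by (auto simp: bij_betw_def)
    have "edge ?c (l x) (l y) \<longleftrightarrow> edge ?c' (l' x) (l' y)"
      using labelling_edge[OF l(1) x(1) y(1) l(2)] labelling_edge[OF l'(1) x(1) y(1) l'(2)] by simp
    then show ?thesis using s(2) t(2) x y by simp
  qed
  from letter_unique_up_to_swaps[OF trans(1) trans(2)[folded same] labels s(1) t(1) this]
  have "?c = ?c'" "t \<longrightarrow> swappable ?c" by blast+
  then show ?thesis using t(2) by (intro conjI exI[of _ t])
qed

lemma labelling_unique:
  assumes l: "labelling l w" "w \<in> words m c" and l': "labelling l' w'" "w' \<in> words m c'"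
  shows "w = w'"
proof -
  have "w ! i = w' ! i \<and> (\<exists>s. (s \<longrightarrow> swappable (w ! i)) \<and> (\<forall>x\<in>level i. l' x \<longleftrightarrow> l x \<noteq> s))"
    if "i \<le> m" for i
    using that
  proof (induction i)
    case 0
    have points: "w ! 0 = Point" "w' ! 0 = Point" using words_nth(2) l(2) l'(2) by auto
    moreover have "bij_betw l (level 0) (labels (w ! 0))" "bij_betw l' (level 0) (labels (w' ! 0))"
      using labelling_bij l(1) l'(1) words_nth(1)[OF l(2)] words_nth(1)[OF l'(2)] by simp_all
    ultimately have "l' x \<longleftrightarrow> l x \<noteq> False" if "x \<in> level 0" for x
      using that by (auto dest!: bij_betwE)
    then show ?case using points by (intro conjI exI[of _ False]) simp_all
  next
    case (Suc i)
    from Suc.IH[OF Suc_leD[OF Suc.prems]] obtain s where same: "w ! i = w' ! i"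
      and s: "s \<longrightarrow> swappable (w ! i)" "\<forall>x\<in>level i. l' x \<longleftrightarrow> l x \<noteq> s"
      by (elim exE conjE)
    show ?case
      using Suc.prems words_nth(1)[OF l(2)] words_nth(1)[OF l'(2)]
      by (intro labelling_unique_Suc[OF l(1) _ l'(1) _ same _ _ s])
        (simp_all add: words_nth(4)[OF l(2)] words_nth(4)[OF l'(2)])
  qed
  then show ?thesis
    using words_nth(1)[OF l(2)] words_nth(1)[OF l'(2)]
    by (simp add: list_eq_iff_nth_eq less_Suc_eq_le)
qed

lemma labelling_cong:
  assumes "\<And>x. x \<in> Field r \<Longrightarrow> rk x < length w \<Longrightarrow> l x = l' x"
  shows "labelling l w \<longleftrightarrow> labelling l' w"
proof -
  have same: "l x = l' x" if "x \<in> level i" "i < length w" for x i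
    using that assms by (simp add: level_def)
  then have "bij_betw l (level i) (labels (w ! i)) \<longleftrightarrow> bij_betw l' (level i) (labels (w ! i))"
    if "i < length w" for i using that by (intro bij_betw_cong) auto
  then show ?thesis unfolding labelling_def using assms by auto
qed

lemma labelling_snoc:
  assumes "length w = Suc i" "labelling l w" "bij_betw l (level (Suc i)) (labels c)"
    and "\<And>x y. x \<in> level i \<Longrightarrow> y \<in> level (Suc i) \<Longrightarrow> (x, y) \<in> r \<longleftrightarrow> edge c (l x) (l y)"
  shows "labelling l (w @ [c])"
  using assms by (auto simp: labelling_def level_def nth_append less_Suc_eq)

lemma labelling_extend:
  assumes w: "length w = Suc i" "labelling l w"
    and f: "bij_betw f (level (Suc i)) (labels c)"
    and edges: "\<And>x y. x \<in> level i \<Longrightarrow> y \<in> level (Suc i) \<Longrightarrow> (x, y) \<in> r \<longleftrightarrow> edge c (l x) (f y)"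
  shows "\<exists>l'. labelling l' (w @ [c]) \<and> (\<forall>y\<in>level (Suc i). l' y = f y)"
proof -
  let ?l = "\<lambda>x. if rk x = Suc i then f x else l x"
  have new: "?l y = f y" if "y \<in> level (Suc i)" for y using that by (simp add: level_def)
  have "labelling ?l (w @ [c])"
  proof (rule labelling_snoc[OF w(1)])
    show "labelling ?l w" using w labelling_cong[of w ?l l] by simp
    show "bij_betw ?l (level (Suc i)) (labels c)"
      using f bij_betw_cong[of "level (Suc i)" ?l f] new by blast
    show "(x, y) \<in> r \<longleftrightarrow> edge c (?l x) (?l y)" if "x \<in> level i" "y \<in> level (Suc i)" for x y
      using edges[OF that] that by (simp add: level_def)
  qed
  then show ?thesis using new by (intro exI[of _ ?l] conjI ballI)
qed

lemma ex_label_relation: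
  assumes i: "Suc i \<le> n" and l: "bij_betw l (level i) K" and f: "bij_betw f (level (Suc i)) L"
  shows "\<exists>E. (\<forall>x\<in>level i. \<forall>y\<in>level (Suc i). (x, y) \<in> r \<longleftrightarrow> E (l x) (f y)) \<and>
    (\<forall>a\<in>K. \<exists>b\<in>L. E a b) \<and> (\<forall>b\<in>L. \<exists>a\<in>K. E a b)"
proof -
  define E where
    "E a b \<longleftrightarrow> (\<exists>x\<in>level i. \<exists>y\<in>level (Suc i). l x = a \<and> f y = b \<and> (x, y) \<in> r)" for a b
  have "(x, y) \<in> r \<longleftrightarrow> E (l x) (f y)" if "x \<in> level i" "y \<in> level (Suc i)" for x y
    using that inj_onD[OF bij_betw_imp_inj_on[OF l]] inj_onD[OF bij_betw_imp_inj_on[OF f]]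
    unfolding E_def by blast
  moreover have "\<exists>b\<in>L. E a b" if a: "a \<in> K" for a
  proof -
    obtain x where x: "x \<in> level i" "l x = a" using a bij_betw_imp_surj_on[OF l] by blast
    then obtain y where "y \<in> level (Suc i)" "(x, y) \<in> r"
      using ex_above[of x "Suc i"] i by (auto simp: level_def)
    then show ?thesis using x bij_betwE[OF f] unfolding E_def by blast
  qed
  moreover have "\<exists>a\<in>K. E a b" if b: "b \<in> L" for b
  proof -
    obtain y where y: "y \<in> level (Suc i)" "f y = b" using b bij_betw_imp_surj_on[OF f] by blast
    then obtain x where "x \<in> level i" "(x, y) \<in> r"
      using ex_below[of y i] by (auto simp: level_def)
    then show ?thesis using y bij_betwE[OF l] unfolding E_def by blast
  qed
  ultimately show ?thesis by (intro exI[of _ E] conjI ballI)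
qed

definition labelling_up_to_swap :: "('a \<Rightarrow> bool) \<Rightarrow> letter list \<Rightarrow> bool" where
  "labelling_up_to_swap l w \<longleftrightarrow> (\<forall>s. (s \<longrightarrow> swappable (last w)) \<longrightarrow>
     (\<exists>l'. labelling l' w \<and> (\<forall>x\<in>level (length w - 1). l' x \<longleftrightarrow> l x \<noteq> s)))"

lemma labelling_up_to_swapD:
  assumes "labelling_up_to_swap l w" "length w = Suc i" "s \<longrightarrow> swappable (last w)"
  shows "\<exists>l'. labelling l' w \<and> (\<forall>x\<in>level i. l' x \<longleftrightarrow> l x \<noteq> s)"
  using assms(1)[unfolded labelling_up_to_swap_def, THEN spec, THEN mp, OF assms(3)] assms(2)
  by simp

lemma labelling_up_to_swap_bij:
  assumes "labelling_up_to_swap l w" "length w = Suc i"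
  shows "bij_betw l (level i) (labels (last w))"
proof -
  have "\<exists>l'. labelling l' w \<and> (\<forall>x\<in>level i. l' x = l x)"
    using labelling_up_to_swapD[OF assms, of False] by simp
  then obtain l' where l': "labelling l' w" "\<forall>x\<in>level i. l' x = l x" by (elim exE conjE)
  then have "bij_betw l' (level i) (labels (w ! i))" using labelling_bij assms(2) by simp
  moreover have "last w = w ! i" using assms(2) by (cases w rule: rev_cases) auto
  ultimately show ?thesis using l'(2) bij_betw_cong[of "level i" l l'] by simp
qed

end

context narrow_poset
begin

lemma ex_bij_level:
  assumes "i \<le> n"
  shows "\<exists>f L. L \<in> {{False}, UNIV} \<and> bij_betw f (level i) L"
proof -
  have "level i \<noteq> {}" using assms level_eq_empty_iff by simp
  then have "card (level i) = 1 \<or> card (level i) = 2"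
    using card_level_le[of i] finite_level[of i] card_gt_0_iff[of "level i"] by linarith
  moreover have "\<exists>f. bij_betw f (level i) L" if "card (level i) = card L" for L :: "bool set"
    using that finite_level by (intro finite_same_card_bij) auto
  moreover have "card {False} = 1" "card (UNIV :: bool set) = 2" by simp_all
  ultimately show ?thesis by (metis insertCI)
qed

lemma labelling_up_to_swap_snoc:
  assumes w: "labelling_up_to_swap l w" "length w = Suc i" and i: "Suc i \<le> n"
  shows "\<exists>c l'. transition (last w) c \<and> labelling_up_to_swap l' (w @ [c])"
proof -
  obtain f L where L: "L \<in> {{False}, UNIV}" and f: "bij_betw f (level (Suc i)) L"
    using ex_bij_level[OF i] by blast
  have l: "bij_betw l (level i) (labels (last w))" using w by (rule labelling_up_to_swap_bij)
  obtain E where E: "\<forall>x\<in>level i. \<forall>y\<in>level (Suc i). (x, y) \<in> r \<longleftrightarrow> E (l x) (f y)"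
    and total: "\<forall>a\<in>labels (last w). \<exists>b\<in>L. E a b" "\<forall>b\<in>L. \<exists>a\<in>labels (last w). E a b"
    using ex_label_relation[OF i l f] by (elim exE conjE)
  obtain c t\<^sub>0 where c: "labels c = L" "t\<^sub>0 \<longrightarrow> L = UNIV" "describes (last w) c t\<^sub>0 E"
    using ex_describes[OF L total] by (elim exE conjE)
  have "\<exists>l'. labelling l' (w @ [c]) \<and> (\<forall>y\<in>level (Suc i). l' y \<longleftrightarrow> (f y \<noteq> t\<^sub>0) \<noteq> t)"
    if t: "t \<longrightarrow> swappable c" for t
  proof -
    obtain s where s: "s \<longrightarrow> swappable (last w)"
      "\<forall>a\<in>labels (last w). \<forall>b\<in>labels c. E a b \<longleftrightarrow> edge c (a \<noteq> s) ((b \<noteq> t\<^sub>0) \<noteq> t)"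
      using c(3) t by (rule describesE)
    obtain l' where l': "labelling l' w" "\<forall>x\<in>level i. l' x \<longleftrightarrow> l x \<noteq> s"
      using labelling_up_to_swapD[OF w s(1)] by (elim exE conjE)
    have "t \<longrightarrow> L = UNIV" using c(1) t by (cases c) auto
    then have "bij_betw (\<lambda>y. (f y \<noteq> t\<^sub>0) \<noteq> t) (level (Suc i)) (labels c)"
      unfolding c(1) by (rule bij_betw_bool_swap[OF bij_betw_bool_swap[OF f c(2)]])
    then show ?thesis
    proof (rule labelling_extend[OF w(2) l'(1)])
      fix x y assume xy: "x \<in> level i" "y \<in> level (Suc i)"
      then have "l x \<in> labels (last w)" "f y \<in> labels c"
        using bij_betwE[OF l] bij_betwE[OF f] c(1) by simp_all
      then show "(x, y) \<in> r \<longleftrightarrow> edge c (l' x) ((f y \<noteq> t\<^sub>0) \<noteq> t)" using E s(2) l'(2) xy by simp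
    qed
  qed
  then have "labelling_up_to_swap (\<lambda>y. f y \<noteq> t\<^sub>0) (w @ [c])"
    using w(2) by (simp add: labelling_up_to_swap_def)
  then show ?thesis using c(3) by (auto simp: describes_def)
qed

lemma ex_labelling_up_to_swap:
  assumes "i \<le> n"
  shows "\<exists>c. \<exists>w\<in>words i c. \<exists>l. labelling_up_to_swap l w"
  using assms
proof (induction i)
  case 0
  obtain z where "level 0 = {z}" using level_0 by blast
  then have "labelling (\<lambda>_. False) [Point]" by (auto simp: labelling_def level_def bij_betw_def)
  then have "labelling_up_to_swap (\<lambda>_. False) [Point]"
    by (auto simp: labelling_up_to_swap_def)
  then show ?case using words_0 by auto
next
  case (Suc i)
  then obtain d w l where w: "w \<in> words i d" "labelling_up_to_swap l w" by auto
  then obtain c l' where c: "transition (last w) c" "labelling_up_to_swap l' (w @ [c])"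
    using labelling_up_to_swap_snoc words_nth(1) Suc.prems by blast
  moreover have "last w = d" using w(1) by (simp add: words_def)
  ultimately show ?case using snoc_in_words w(1) by blast
qed

lemma ex_poset_iso_word_poset: "\<exists>w\<in>words n Point. poset_iso r (word_poset w)"
proof -
  obtain c w l where w: "w \<in> words n c" "labelling l w"
    using ex_labelling_up_to_swap[of n] unfolding labelling_up_to_swap_def by blast
  have "bij_betw l (level n) (labels c)"
    using w words_nth(1,3)[OF w(1)] by (auto simp: labelling_def)
  then have "card (labels c) = 1" using level_n by (auto dest: bij_betw_same_card)
  then have "c = Point" by (cases c) auto
  then show ?thesis using w poset_iso_word_poset_iff by blast
qed

end

section \<open>Counting words\<close>

lemma narrow_iso_word_unique:
  assumes "narrow n r" "w \<in> words n Point" "w' \<in> words n Point"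
    and "poset_iso r (word_poset w)" "poset_iso r (word_poset w')"
  shows "w = w'"
proof -
  obtain rk where "narrow_poset r n rk" using assms(1) by (auto simp: narrow_def)
  then interpret narrow_poset r n rk .
  obtain l where "labelling l w" using assms(4) poset_iso_word_poset_iff[OF assms(2)] by blast
  moreover obtain l' where "labelling l' w'"
    using assms(5) poset_iso_word_poset_iff[OF assms(3)] by blast
  ultimately show ?thesis using labelling_unique[OF _ assms(2) _ assms(3)] by blast
qed

definition canonical_word :: "nat \<Rightarrow> 'a rel \<Rightarrow> letter list" where
  "canonical_word n r = (SOME w. w \<in> words n Point \<and> poset_iso r (word_poset w))"

lemma canonical_word:
  assumes "narrow n r"
  shows "canonical_word n r \<in> words n Point" "poset_iso r (word_poset (canonical_word n r))"
proof -
  have "\<exists>w. w \<in> words n Point \<and> poset_iso r (word_poset w)"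
    using assms narrow_poset.ex_poset_iso_word_poset unfolding narrow_def by blast
  from someI_ex[OF this]
  show "canonical_word n r \<in> words n Point" "poset_iso r (word_poset (canonical_word n r))"
    by (simp_all add: canonical_word_def)
qed

lemma canonical_word_eqI:
  assumes "narrow n r" "w \<in> words n Point" "poset_iso r (word_poset w)"
  shows "canonical_word n r = w"
  using assms(1) canonical_word(1)[OF assms(1)] assms(2) canonical_word(2)[OF assms(1)] assms(3)
  by (rule narrow_iso_word_unique)

lemma poset_iso_iff_canonical_word:
  assumes "narrow n r" "narrow n s"
  shows "poset_iso r s \<longleftrightarrow> canonical_word n r = canonical_word n s"
proof
  assume "poset_iso r s"
  then have "poset_iso r (word_poset (canonical_word n s))"
    using canonical_word(2)[OF assms(2)] by (rule poset_iso_trans)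
  then show "canonical_word n r = canonical_word n s"
    using assms(1) canonical_word(1)[OF assms(2)] by (intro canonical_word_eqI)
next
  assume "canonical_word n r = canonical_word n s"
  then have "poset_iso r (word_poset (canonical_word n s))"
    using canonical_word(2)[OF assms(1)] by simp
  then show "poset_iso r s"
    using poset_iso_sym[OF canonical_word(2)[OF assms(2)]] by (rule poset_iso_trans)
qed

definition weight :: "letter list \<Rightarrow> nat" where
  "weight w = (\<Sum>c\<leftarrow>w. card (labels c))"

lemma card_word_carrier: "card (word_carrier w) = weight w"
  by (simp add: word_carrier_def weight_def sum_list_sum_nth atLeast0LessThan)

lemma length_le_weight: "length w \<le> weight w"
proof -
  have "1 \<le> card (labels c)" for c by (cases c) simp_all
  then have "(\<Sum>c\<leftarrow>w. 1) \<le> weight w" unfolding weight_def by (rule sum_list_mono)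
  then show ?thesis by (simp add: sum_list_triv)
qed

lemma canonical_word_image_mf_posets:
  "canonical_word n ` mf_posets n k = {w \<in> words n Point. weight w = k}"
proof (intro equalityI subsetI)
  fix w assume "w \<in> canonical_word n ` mf_posets n k"
  then obtain r where r: "narrow n r" "Field r = {..<k}" "w = canonical_word n r"
    by (auto simp: mf_posets_eq)
  then have "card (Field r) = weight w"
    using poset_iso_card[OF canonical_word(2)[OF r(1)]]
    by (simp add: Field_word_poset card_word_carrier)
  then show "w \<in> {w \<in> words n Point. weight w = k}"
    using canonical_word(1)[OF r(1)] r(2,3) by simp
next
  fix w assume "w \<in> {w \<in> words n Point. weight w = k}"
  then have w: "w \<in> words n Point" "weight w = k" by simp_all
  have narrow: "narrow n (word_poset w)" using narrow_word_poset[OF w(1)] by (auto simp: narrow_def)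
  interpret narrow_poset "word_poset w" n fst using w(1) by (rule narrow_word_poset)
  obtain r :: "nat rel" where r: "Field r = {..<k}" "poset_iso (word_poset w) r"
    using poset_iso_standard_carrier[OF finite_Field partial_order, of k] w(2)
    by (auto simp: Field_word_poset card_word_carrier)
  have iso: "poset_iso r (word_poset w)" using r(2) by (rule poset_iso_sym)
  with narrow have "narrow n r" by (rule narrow_poset_iso)
  then have "canonical_word n r = w" using w(1) iso by (rule canonical_word_eqI)
  moreover have "r \<in> mf_posets n k" using r(1) \<open>narrow n r\<close> by (simp add: mf_posets_eq)
  ultimately show "w \<in> canonical_word n ` mf_posets n k" by blast
qed

lemma card_quotient_eq_card_image:
  assumes "\<And>x y. x \<in> A \<Longrightarrow> y \<in> A \<Longrightarrow> R x y \<longleftrightarrow> f x = f y"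
  shows "card (A // {(x, y). x \<in> A \<and> y \<in> A \<and> R x y}) = card (f ` A)"
proof -
  let ?R = "{(x, y). x \<in> A \<and> y \<in> A \<and> R x y}"
  let ?fibre = "\<lambda>b. {y \<in> A. f y = b}"
  have "?R `` {x} = ?fibre (f x)" if "x \<in> A" for x using that assms by auto
  then have "A // ?R = ?fibre ` f ` A" unfolding quotient_def by (auto simp: image_image)
  moreover have "inj_on ?fibre (f ` A)" by (rule inj_onI) blast
  ultimately show ?thesis by (simp add: card_image)
qed

lemma num_mf_posets_eq: "num_mf_posets n k = card {w \<in> words n Point. weight w = k}"
proof -
  have "poset_iso r s \<longleftrightarrow> canonical_word n r = canonical_word n s"
    if "r \<in> mf_posets n k" "s \<in> mf_posets n k" for r s
    using that by (intro poset_iso_iff_canonical_word) (simp_all add: mf_posets_eq)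
  then show ?thesis
    unfolding num_mf_posets_def canonical_word_image_mf_posets[symmetric]
    by (rule card_quotient_eq_card_image)
qed

lemma finite_words: "finite (words n c)"
proof -
  have "finite {w :: letter list. set w \<subseteq> UNIV \<and> length w = Suc n}"
    by (rule finite_lists_length_eq) simp
  then show ?thesis by (rule rev_finite_subset) (auto simp: words_def)
qed

section \<open>Generating functions\<close>

unbundle fps_syntax

definition word_gf :: "nat \<Rightarrow> letter \<Rightarrow> rat fps" where
  "word_gf n c = (\<Sum>w\<in>words n c. fps_X ^ weight w)"

lemma word_gf_nth: "word_gf n c $ k = of_nat (card {w \<in> words n c. weight w = k})"
proof -
  have "word_gf n c $ k = (\<Sum>w\<in>words n c. if weight w = k then 1 else 0)"
    by (auto simp: word_gf_def fps_sum_nth fps_X_power_nth intro!: sum.cong)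
  also have "\<dots> = of_nat (card {w \<in> words n c. weight w = k})"
    using finite_words[of n c] by (simp add: sum.If_cases Int_def)
  finally show ?thesis .
qed

lemma word_gf_0: "word_gf 0 c = (if c = Point then fps_X else 0)"
  by (simp add: word_gf_def words_0 weight_def)

lemma word_gf_Suc:
  "word_gf (Suc n) c = fps_X ^ card (labels c) * (\<Sum>d\<in>{d. transition d c}. word_gf n d)"
proof -
  have "word_gf (Suc n) c =
      (\<Sum>d\<in>{d. transition d c}. \<Sum>w\<in>(\<lambda>w. w @ [c]) ` words n d. fps_X ^ weight w)"
    unfolding word_gf_def words_Suc
    by (rule sum.UNION_disjoint) (use finite_words in \<open>auto simp: words_def\<close>)
  also have "\<dots> = (\<Sum>d\<in>{d. transition d c}. fps_X ^ card (labels c) * word_gf n d)"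
    by (intro sum.cong refl, subst sum.reindex)
      (auto simp: inj_on_def word_gf_def weight_def power_add mult.commute sum_distrib_left)
  finally show ?thesis by (simp add: sum_distrib_left)
qed

definition word_series :: "letter \<Rightarrow> rat fps fps" where
  "word_series c = Abs_fps (\<lambda>n. word_gf n c)"

lemma word_series_eq:
  "word_series c = (if c = Point then vary else 0) +
     varx * vary ^ card (labels c) * (\<Sum>d\<in>{d. transition d c}. word_series d)"
    (is "_ = ?init + varx * vary ^ ?k * ?S")
proof (rule fps_ext)
  fix n
  have S_nth: "?S $ m = (\<Sum>d\<in>{d. transition d c}. word_gf m d)" for m
    by (simp add: fps_sum_nth word_series_def)
  have "varx * vary ^ ?k * ?S = fps_X * (fps_const (fps_X ^ ?k) * ?S)"
    by (simp only: varx_def vary_def fps_const_power mult.assoc)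
  then have "(varx * vary ^ ?k * ?S) $ n = (if n = 0 then 0 else fps_X ^ ?k * ?S $ (n - 1))"
    by (simp only: fps_X_mult_nth fps_mult_left_const_nth)
  also have "\<dots> = (if n = 0 then 0 else word_gf n c)"
    by (cases n) (simp_all only: S_nth word_gf_Suc, simp_all)
  finally show "word_series c $ n = (?init + varx * vary ^ ?k * ?S) $ n"
    by (simp add: word_series_def vary_def word_gf_0)
qed

lemma U_series_eq: "U_series = word_series Point - vary"
proof (intro fps_ext)
  fix n k
  show "U_series $ n $ k = (word_series Point - vary) $ n $ k"
  proof (cases n)
    case 0
    then show ?thesis by (simp add: U_series_def word_series_def vary_def word_gf_0)
  next
    case (Suc m)
    have "2 \<le> weight w" if "w \<in> words n Point" for w
      using length_le_weight[of w] words_nth(1)[OF that] Suc by simp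
    then have "num_mf_posets n k = 0" if "k < 2"
      unfolding num_mf_posets_eq using that by (force simp: card_eq_0_iff)
    then show ?thesis using Suc
      by (auto simp: U_series_nth word_series_def vary_def word_gf_nth simp flip: num_mf_posets_eq)
  qed
qed

lemma word_series_system:
  defines "S \<equiv> word_series Full + word_series Free_Match"
    and "R \<equiv> word_series Rigid_Match + word_series Up + word_series Down"
  shows "word_series Point = vary + varx * vary * (word_series Point + S + R)"
    and "S = varx * vary ^ 2 * (word_series Point + 2 * S + R)"
    and "R = varx * vary ^ 2 * (S + 3 * R)"
proof -
  have "d \<in> {d. swappable d} \<longleftrightarrow> d \<in> {Full, Free_Match}"
    "d \<in> {d. rigid d} \<longleftrightarrow> d \<in> {Rigid_Match, Up, Down}"
    "d \<in> {d. d \<noteq> Point} \<longleftrightarrow> d \<in> {Full, Free_Match, Rigid_Match, Up, Down}" for d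
    by (cases d; simp)+
  note predecessors = this[THEN set_eqI]
  show "word_series Point = vary + varx * vary * (word_series Point + S + R)"
    by (subst word_series_eq) (simp add: UNIV_letter predecessors S_def R_def add.assoc)
  have pair_swappable: "word_series Full = varx * vary ^ 2 * (word_series Point + S + R)"
    "word_series Free_Match = varx * vary ^ 2 * S"
    by (subst word_series_eq, simp add: UNIV_letter predecessors S_def R_def add.assoc)+
  have "S = word_series Full + word_series Free_Match" by (simp only: S_def)
  also have "\<dots> = varx * vary ^ 2 * (word_series Point + 2 * S + R)"
    unfolding pair_swappable by (simp add: algebra_simps)
  finally show "S = varx * vary ^ 2 * (word_series Point + 2 * S + R)" .
  have pair_rigid: "word_series Rigid_Match = varx * vary ^ 2 * R"
    "word_series Up = varx * vary ^ 2 * (S + R)" "word_series Down = varx * vary ^ 2 * R"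
    by (subst word_series_eq, simp add: predecessors S_def R_def add.assoc)+
  have "R = word_series Rigid_Match + word_series Up + word_series Down" by (simp only: R_def)
  also have "\<dots> = varx * vary ^ 2 * (S + 3 * R)"
    unfolding pair_rigid by (simp add: algebra_simps)
  finally show "R = varx * vary ^ 2 * (S + 3 * R)" .
qed

lemma automaton_system_solution:
  fixes A S R x y :: "'a :: comm_ring_1"
  assumes "A = y + x * y * (A + S + R)"
    and "S = x * y ^ 2 * (A + 2 * S + R)"
    and "R = x * y ^ 2 * (S + 3 * R)"
  shows "(A - y) * (1 - x * y - 5 * x * y ^ 2 + 4 * x ^ 2 * y ^ 3
      + 5 * x ^ 2 * y ^ 4 - 3 * x ^ 3 * y ^ 5) = x * y ^ 2 * (1 - x * y ^ 2) * (1 - 3 * x * y ^ 2)"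
    (is "?lhs = ?rhs")
proof -
  define z where "z = x * y ^ 2"
  have "?lhs - ?rhs = (1 - 5 * z + 5 * z ^ 2) * (A - (y + x * y * (A + S + R))) +
      x * y * (1 - 2 * z) * (S - z * (A + 2 * S + R)) + x * y * (1 - z) * (R - z * (S + 3 * R))"
    unfolding z_def by (simp add: algebra_simps eval_nat_numeral)
  moreover have "A - (y + x * y * (A + S + R)) = 0" "S - z * (A + 2 * S + R) = 0"
    "R - z * (S + 3 * R) = 0" using assms unfolding z_def by (simp_all only: right_minus_eq)
  ultimately show ?thesis by (simp only: mult_zero_right add_0 right_minus_eq)
qed

theorem theorem4p2:
  shows "U_series =
    (varx * vary ^ 2 * (1 - varx * vary ^ 2) * (1 - 3 * varx * vary ^ 2)) /
    (1 - varx * vary - 5 * varx * vary ^ 2 + 4 * varx ^ 2 * vary ^ 3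
       + 5 * varx ^ 2 * vary ^ 4 - 3 * varx ^ 3 * vary ^ 5)"
    (is "_ = ?N / ?D")
proof -
  have "U_series * ?D = ?N"
    unfolding U_series_eq by (rule automaton_system_solution[OF word_series_system])
  moreover have D_0: "?D $ 0 = 1" by (simp add: varx_def)
  then have "?N / ?D * ?D = ?N" by (rule fps_fps_divide_cancel)
  moreover have "?D \<noteq> 0" using D_0 by (metis fps_zero_nth zero_neq_one)
  ultimately show ?thesis by (metis mult_right_cancel)
qed

end
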